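(* Let $E$ be an $(n+m)$-dimensional smooth manifold and let $\Gamma$ be a torsion-free linear connection on the tangent bundle $TE\to E$. Then with the connection $\Gamma$ there is naturally associated a connection $\dot\Gamma$ on the bundle $\pi_{1,0}\colon J^1(E,n)\to E$.
   Context: $J^1(E,n)$ is the manifold of first-order contact classes $[L]^1_p$ of $n$-dimensional embedded submanifolds $L\subset E$ at points $p\in L$. The class $[L]^1_p$ can be identified with the tangent space $T_pL$, so $J^1(E,n)$ is the Grassmann bundle over $E$ of $n$-dimensional subspaces of $TE$. The projection $\pi_{1,0}$ sends $[L]^1_p$ to $p$. A connection on a bundle $\rho\colon F\to N$ is a section of the first jet bundle $J^1\rho\to F$. Equivalently, it is given by its vertical projection $TF\to VF=\ker T\rho$, or by its horizontal lift $F\to\rho^*(T^*N)\otimes_F TF$. *)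

theory Defs
  imports "HOL-Analysis.Analysis"
begin

text \<open>In finite dimension, being of class C^(k+1) on an open set amounts to being differentiable
  with all directional derivatives of class C^k.\<close>

primrec Ck_on :: "nat \<Rightarrow> 'a::euclidean_space set \<Rightarrow> ('a \<Rightarrow> 'b::euclidean_space) \<Rightarrow> bool" where
  "Ck_on 0 S f \<longleftrightarrow> continuous_on S f"
| "Ck_on (Suc k) S f \<longleftrightarrow> (\<forall>x\<in>S. f differentiable (at x)) \<and>
     (\<forall>v. Ck_on k S (\<lambda>x. frechet_derivative f (at x) v))"

definition smooth_on :: "'a::euclidean_space set \<Rightarrow> ('a \<Rightarrow> 'b::euclidean_space) \<Rightarrow> bool" where
  "smooth_on S f \<longleftrightarrow> (\<forall>k. Ck_on k S f)"

text \<open>A manifold is given by an atlas: a set of charts (U, phi) whose domains cover the underlying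
  set. The topology is the one induced by the charts. Atlases are not required to be maximal.
  The values of phi outside U are irrelevant.\<close>

type_synonym ('a, 'v) chart = "'a set \<times> ('a \<Rightarrow> 'v)"
type_synonym ('a, 'v) atlas = "('a, 'v) chart set"

definition points :: "('a, 'v) atlas \<Rightarrow> 'a set" where
  "points A = (\<Union>c\<in>A. fst c)"

definition charts_at :: "('a, 'v) atlas \<Rightarrow> 'a \<Rightarrow> ('a, 'v) chart set" where
  "charts_at A p = {c \<in> A. p \<in> fst c}"

definition chart_inv :: "('a, 'v) chart \<Rightarrow> 'v \<Rightarrow> 'a" where
  "chart_inv c = inv_into (fst c) (snd c)"

definition atlas_topology :: "('a, 'v::topological_space) atlas \<Rightarrow> 'a topology" where
  "atlas_topology A = topology (\<lambda>S. S \<subseteq> points A \<and> (\<forall>c\<in>A. open (snd c ` (S \<inter> fst c))))"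

definition local_rep ::
    "('a, 'v) chart \<Rightarrow> ('b, 'w) chart \<Rightarrow> ('a \<Rightarrow> 'b) \<Rightarrow> 'v \<Rightarrow> 'w" where
  "local_rep c d f = snd d \<circ> f \<circ> chart_inv c"

definition smooth_manifold :: "('a, 'v::euclidean_space) atlas \<Rightarrow> bool" where
  "smooth_manifold A \<longleftrightarrow>
     (\<forall>c\<in>A. inj_on (snd c) (fst c) \<and> open (snd c ` fst c)) \<and>
     (\<forall>c\<in>A. \<forall>d\<in>A. open (snd c ` (fst c \<inter> fst d)) \<and>
        smooth_on (snd c ` (fst c \<inter> fst d)) (local_rep c d (\<lambda>p. p))) \<and>
     Hausdorff_space (atlas_topology A) \<and> second_countable (atlas_topology A)"

lemma openin_atlas_topology:
  fixes A :: "('a, 'v::euclidean_space) atlas"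
  assumes "\<forall>c\<in>A. inj_on (snd c) (fst c)"
  shows "openin (atlas_topology A) S \<longleftrightarrow>
    S \<subseteq> points A \<and> (\<forall>c\<in>A. open (snd c ` (S \<inter> fst c)))"
proof -
  have "istopology (\<lambda>S. S \<subseteq> points A \<and> (\<forall>c\<in>A. open (snd c ` (S \<inter> fst c))))"
    unfolding istopology_def
  proof (intro conjI allI impI ballI)
    fix S T :: "'a set" and c
    assume S: "S \<subseteq> points A \<and> (\<forall>c\<in>A. open (snd c ` (S \<inter> fst c)))"
      and T: "T \<subseteq> points A \<and> (\<forall>c\<in>A. open (snd c ` (T \<inter> fst c)))" and c: "c \<in> A"
    have "snd c ` ((S \<inter> T) \<inter> fst c) = snd c ` (S \<inter> fst c) \<inter> snd c ` (T \<inter> fst c)"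
      using assms c by (auto dest: inj_onD)
    then show "open (snd c ` ((S \<inter> T) \<inter> fst c))" using S T c by auto
  next
    fix K :: "'a set set" and c
    assume K: "\<forall>S\<in>K. S \<subseteq> points A \<and> (\<forall>c\<in>A. open (snd c ` (S \<inter> fst c)))" and c: "c \<in> A"
    have "snd c ` (\<Union>K \<inter> fst c) = (\<Union>S\<in>K. snd c ` (S \<inter> fst c))" by auto
    then show "open (snd c ` (\<Union>K \<inter> fst c))" using K c by auto
  qed auto
  then show ?thesis by (simp add: atlas_topology_def topology_inverse')
qed

definition smooth_map ::
    "('a, 'v::euclidean_space) atlas \<Rightarrow> ('b, 'w::euclidean_space) atlas \<Rightarrow> ('a \<Rightarrow> 'b) \<Rightarrow> bool" where
  "smooth_map A B f \<longleftrightarrow> f ` points A \<subseteq> points B \<and>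
     (\<forall>c\<in>A. \<forall>d\<in>B. open (snd c ` {p \<in> fst c. f p \<in> fst d}) \<and>
        smooth_on (snd c ` {p \<in> fst c. f p \<in> fst d}) (local_rep c d f))"

definition diffeomorphism ::
    "('a, 'v::euclidean_space) atlas \<Rightarrow> ('b, 'w::euclidean_space) atlas \<Rightarrow> ('a \<Rightarrow> 'b) \<Rightarrow> bool" where
  "diffeomorphism A B f \<longleftrightarrow> bij_betw f (points A) (points B) \<and>
     smooth_map A B f \<and> smooth_map B A (inv_into (points A) f)"

definition restrict_atlas :: "('a, 'v) atlas \<Rightarrow> 'a set \<Rightarrow> ('a, 'v) atlas" where
  "restrict_atlas A S = (\<lambda>c. (fst c \<inter> S, snd c)) ` A"

definition local_diffeomorphism ::
    "('a, 'v::euclidean_space) atlas \<Rightarrow> ('b, 'w::euclidean_space) atlas \<Rightarrow> ('a \<Rightarrow> 'b) \<Rightarrow> bool" where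
  "local_diffeomorphism A B f \<longleftrightarrow>
     (\<forall>p\<in>points A. \<exists>S. p \<in> S \<and> openin (atlas_topology A) S \<and> openin (atlas_topology B) (f ` S) \<and>
        diffeomorphism (restrict_atlas A S) (restrict_atlas B (f ` S)) f)"

text \<open>A tangent vector at p is the family of its components in all charts around p (and 0 in
  the remaining slots); components in different charts are related by the Jacobian of the
  change of coordinates. Vector space operations are taken componentwise.\<close>

type_synonym ('a, 'v) tvec = "('a, 'v) chart \<Rightarrow> 'v"

definition jacobian ::
    "('a, 'v::euclidean_space) chart \<Rightarrow> ('b, 'w::euclidean_space) chart \<Rightarrow> ('a \<Rightarrow> 'b) \<Rightarrow> 'a \<Rightarrow> 'v \<Rightarrow> 'w"
  where "jacobian c d f p = frechet_derivative (local_rep c d f) (at (snd c p))"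

definition tangent_space :: "('a, 'v::euclidean_space) atlas \<Rightarrow> 'a \<Rightarrow> ('a, 'v) tvec set" where
  "tangent_space A p = {\<xi>.
     (\<forall>c. c \<notin> charts_at A p \<longrightarrow> \<xi> c = 0) \<and>
     (\<forall>c\<in>charts_at A p. \<forall>d\<in>charts_at A p. \<xi> d = jacobian c d (\<lambda>q. q) p (\<xi> c))}"

definition tvec_of ::
    "('a, 'v::euclidean_space) atlas \<Rightarrow> ('a, 'v) chart \<Rightarrow> 'a \<Rightarrow> 'v \<Rightarrow> ('a, 'v) tvec" where
  "tvec_of A c p v = (\<lambda>d. if d \<in> charts_at A p then jacobian c d (\<lambda>q. q) p v else 0)"

definition tangent_map ::
    "('a, 'v::euclidean_space) atlas \<Rightarrow> ('b, 'w::euclidean_space) atlas \<Rightarrow> ('a \<Rightarrow> 'b) \<Rightarrow>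
     'a \<Rightarrow> ('a, 'v) tvec \<Rightarrow> ('b, 'w) tvec" where
  "tangent_map A B f p \<xi> = (\<lambda>d. if d \<in> charts_at B (f p)
     then (let c = (SOME c. c \<in> charts_at A p) in jacobian c d f p (\<xi> c)) else 0)"

definition tangent_chart ::
    "('a, 'v::euclidean_space) atlas \<Rightarrow> ('a, 'v) chart \<Rightarrow> ('a \<times> ('a, 'v) tvec, 'v \<times> 'v) chart" where
  "tangent_chart A c =
     ({(p, \<xi>). p \<in> fst c \<and> \<xi> \<in> tangent_space A p}, \<lambda>(p, \<xi>). (snd c p, \<xi> c))"

definition tangent_bundle ::
    "('a, 'v::euclidean_space) atlas \<Rightarrow> ('a \<times> ('a, 'v) tvec, 'v \<times> 'v) atlas" where
  "tangent_bundle A = tangent_chart A ` A"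

definition tangent_lift ::
    "('a, 'v::euclidean_space) atlas \<Rightarrow> ('b, 'w::euclidean_space) atlas \<Rightarrow> ('a \<Rightarrow> 'b) \<Rightarrow>
     'a \<times> ('a, 'v) tvec \<Rightarrow> 'b \<times> ('b, 'w) tvec" where
  "tangent_lift A B f = (\<lambda>(p, \<xi>). (f p, tangent_map A B f p \<xi>))"

text \<open>A connection on \<rho> : F \<rightarrow> N, given by its horizontal lift: \<open>h y \<xi>\<close>, for y in F and \<xi> a tangent
  vector of N at \<rho>(y), is the horizontal vector at y lying over \<xi>. Only these arguments matter.
  Smoothness of h, as a section of \<rho>*(T*N) \<otimes> TF, is expressed by its components in charts d of F
  and c of N.\<close>

type_synonym ('a, 'v, 'y, 'w) lift = "'y \<Rightarrow> ('a, 'v) tvec \<Rightarrow> ('y, 'w) tvec"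

definition connection ::
    "('a, 'v::euclidean_space) atlas \<Rightarrow> ('y, 'w::euclidean_space) atlas \<Rightarrow> ('y \<Rightarrow> 'a) \<Rightarrow>
     ('a, 'v, 'y, 'w) lift \<Rightarrow> bool" where
  "connection N F \<rho> h \<longleftrightarrow>
     (\<forall>y\<in>points F. \<forall>\<xi>\<in>tangent_space N (\<rho> y).
        h y \<xi> \<in> tangent_space F y \<and> tangent_map F N \<rho> y (h y \<xi>) = \<xi>) \<and>
     (\<forall>y\<in>points F. \<forall>\<xi>\<in>tangent_space N (\<rho> y). \<forall>\<eta>\<in>tangent_space N (\<rho> y). \<forall>a b :: real.
        h y (\<lambda>c. a *\<^sub>R \<xi> c + b *\<^sub>R \<eta> c) = (\<lambda>d. a *\<^sub>R h y \<xi> d + b *\<^sub>R h y \<eta> d)) \<and>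
     (\<forall>c\<in>N. \<forall>d\<in>F. \<forall>v. smooth_on (snd d ` {y \<in> fst d. \<rho> y \<in> fst c})
        (\<lambda>z. let y = chart_inv d z in h y (tvec_of N c (\<rho> y) v) d))"

text \<open>The connections h and h' on \<rho> : F \<rightarrow> N and \<rho>' : F' \<rightarrow> N' are related by the bundle morphism
  fhat : F \<rightarrow> F' over f : N \<rightarrow> N' if T fhat maps the horizontal lift of \<xi> at y to the horizontal
  lift of Tf(\<xi>) at fhat(y).\<close>

definition related_connections ::
    "('a, 'v::euclidean_space) atlas \<Rightarrow> ('y, 'w::euclidean_space) atlas \<Rightarrow> ('y \<Rightarrow> 'a) \<Rightarrow>
     ('b, 'v2::euclidean_space) atlas \<Rightarrow> ('z, 'w2::euclidean_space) atlas \<Rightarrow>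
     ('a \<Rightarrow> 'b) \<Rightarrow> ('y \<Rightarrow> 'z) \<Rightarrow>
     ('a, 'v, 'y, 'w) lift \<Rightarrow> ('b, 'v2, 'z, 'w2) lift \<Rightarrow> bool" where
  "related_connections N F \<rho> N' F' f fhat h h' \<longleftrightarrow>
     (\<forall>y\<in>points F. \<forall>\<xi>\<in>tangent_space N (\<rho> y).
        tangent_map F F' fhat y (h y \<xi>) = h' (fhat y) (tangent_map N N' f (\<rho> y) \<xi>))"

type_synonym ('a, 'v) tangent_lifting = "('a, 'v, 'a \<times> ('a, 'v) tvec, 'v \<times> 'v) lift"

text \<open>The component in the fibre direction of the horizontal lift of \<xi> at \<open>(p, \<eta>)\<close>, with respect to
  the coordinates on TE induced by the chart c; in classical notation
  \<open>\<Gamma>\<^sub>\<lambda>\<^sup>\<mu>\<^sub>\<nu> \<xi>\<^sup>\<lambda> \<eta>\<^sup>\<nu>\<close>, when the horizontal lift of \<open>\<partial>\<^sub>\<lambda>\<close> is written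
  \<open>\<partial>\<^sub>\<lambda> + \<Gamma>\<^sub>\<lambda>\<^sup>\<mu>\<^sub>\<nu> \<eta>\<^sup>\<nu> \<partial>/\<partial>\<eta>\<^sup>\<mu>\<close>.\<close>

definition lift_coeff ::
    "('a, 'v::euclidean_space) atlas \<Rightarrow> ('a, 'v) tangent_lifting \<Rightarrow> ('a, 'v) chart \<Rightarrow> 'a \<Rightarrow>
     ('a, 'v) tvec \<Rightarrow> ('a, 'v) tvec \<Rightarrow> 'v" where
  "lift_coeff E \<Gamma> c p \<xi> \<eta> = snd (\<Gamma> (p, \<eta>) \<xi> (tangent_chart E c))"

definition linear_connection ::
    "('a, 'v::euclidean_space) atlas \<Rightarrow> ('a, 'v) tangent_lifting \<Rightarrow> bool" where
  "linear_connection E \<Gamma> \<longleftrightarrow> connection E (tangent_bundle E) fst \<Gamma> \<and>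
     (\<forall>c\<in>E. \<forall>p\<in>fst c. \<forall>\<xi>\<in>tangent_space E p. \<forall>\<eta>\<in>tangent_space E p. \<forall>\<zeta>\<in>tangent_space E p.
        \<forall>a b :: real. lift_coeff E \<Gamma> c p \<xi> (\<lambda>c. a *\<^sub>R \<eta> c + b *\<^sub>R \<zeta> c) =
          a *\<^sub>R lift_coeff E \<Gamma> c p \<xi> \<eta> + b *\<^sub>R lift_coeff E \<Gamma> c p \<xi> \<zeta>)"

definition vector_field_on ::
    "('a, 'v::euclidean_space) atlas \<Rightarrow> 'a set \<Rightarrow> ('a \<Rightarrow> ('a, 'v) tvec) \<Rightarrow> bool" where
  "vector_field_on E S X \<longleftrightarrow> (\<forall>p\<in>S. X p \<in> tangent_space E p) \<and>
     (\<forall>c\<in>E. smooth_on (snd c ` (S \<inter> fst c)) (\<lambda>x. X (chart_inv c x) c))"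

definition field_deriv ::
    "('a, 'v::euclidean_space) chart \<Rightarrow> ('a \<Rightarrow> ('a, 'v) tvec) \<Rightarrow> 'a \<Rightarrow> 'v \<Rightarrow> 'v" where
  "field_deriv c Y p = frechet_derivative (\<lambda>x. Y (chart_inv c x) c) (at (snd c p))"

text \<open>The covariant derivative is the vertical part of TY(\<xi>), i.e. TY(\<xi>) minus the horizontal lift
  of \<xi> at Y(p), under the identification of vertical vectors with tangent vectors of E.\<close>

definition covariant_derivative ::
    "('a, 'v::euclidean_space) atlas \<Rightarrow> ('a, 'v) tangent_lifting \<Rightarrow> 'a \<Rightarrow> ('a, 'v) tvec \<Rightarrow>
     ('a \<Rightarrow> ('a, 'v) tvec) \<Rightarrow> ('a, 'v) tvec" where
  "covariant_derivative E \<Gamma> p \<xi> Y = (\<lambda>c. if c \<in> charts_at E p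
     then field_deriv c Y p (\<xi> c) - lift_coeff E \<Gamma> c p \<xi> (Y p) else 0)"

definition lie_bracket ::
    "('a, 'v::euclidean_space) atlas \<Rightarrow> ('a \<Rightarrow> ('a, 'v) tvec) \<Rightarrow> ('a \<Rightarrow> ('a, 'v) tvec) \<Rightarrow>
     'a \<Rightarrow> ('a, 'v) tvec" where
  "lie_bracket E X Y p = (\<lambda>c. if c \<in> charts_at E p
     then field_deriv c Y p (X p c) - field_deriv c X p (Y p c) else 0)"

definition torsion_free ::
    "('a, 'v::euclidean_space) atlas \<Rightarrow> ('a, 'v) tangent_lifting \<Rightarrow> bool" where
  "torsion_free E \<Gamma> \<longleftrightarrow>
     (\<forall>S X Y. openin (atlas_topology E) S \<and> vector_field_on E S X \<and> vector_field_on E S Y \<longrightarrow>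
        (\<forall>p\<in>S. (\<lambda>c. covariant_derivative E \<Gamma> p (X p) Y c - covariant_derivative E \<Gamma> p (Y p) X c) =
          lie_bracket E X Y p))"

text \<open>E is modelled on the space of vectors indexed by \<open>'n + 'm\<close>, so that its dimension is
  \<open>n + m\<close> with \<open>n = CARD('n)\<close> and \<open>m = CARD('m)\<close>. A contact class of n-dimensional submanifolds
  at p is identified with its tangent space, an n-dimensional subspace of the tangent space of E
  at p.\<close>

definition tangent_planes ::
    "('a, real^('n::finite + 'm::finite)) atlas \<Rightarrow> 'a \<Rightarrow> ('a, real^('n + 'm)) tvec set set" where
  "tangent_planes E p = {W. W \<subseteq> tangent_space E p \<and>
     (\<forall>c\<in>charts_at E p. subspace ((\<lambda>\<xi>. \<xi> c) ` W) \<and> dim ((\<lambda>\<xi>. \<xi> c) ` W) = CARD('n))}"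

text \<open>The graph of the linear map with matrix Y from the first n to the last m coordinates.\<close>

definition graph_plane :: "real^'n^'m \<Rightarrow> (real^('n::finite + 'm::finite)) set" where
  "graph_plane Y = {z. (\<chi> j. z $ Inr j) = Y *v (\<chi> i. z $ Inl i)}"

text \<open>The standard coordinates \<open>(x\<^sup>\<lambda>, y\<^sup>i, y\<^sup>i\<^sub>\<lambda>)\<close> cover only those planes
  that are transversal to the last m coordinate directions. As atlases are not maximal, each chart
  is therefore combined with arbitrary linear changes of coordinates G of the fibres, in order to
  cover all planes.\<close>

definition plane_chart ::
    "('a, real^('n::finite + 'm::finite)) atlas \<Rightarrow> ('a, real^('n + 'm)) chart \<Rightarrow>
     real^('n + 'm)^('n + 'm) \<Rightarrow>
     ('a \<times> ('a, real^('n + 'm)) tvec set, (real^('n + 'm)) \<times> (real^'n^'m)) chart" where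
  "plane_chart E c G =
     ({(p, W). p \<in> fst c \<and> W \<in> tangent_planes E p \<and>
         (\<exists>Y. (\<lambda>\<xi>. G *v \<xi> c) ` W = graph_plane Y)},
      \<lambda>(p, W). (snd c p, THE Y. (\<lambda>\<xi>. G *v \<xi> c) ` W = graph_plane Y))"

definition J1 ::
    "('a, real^('n::finite + 'm::finite)) atlas \<Rightarrow>
     ('a \<times> ('a, real^('n + 'm)) tvec set, (real^('n + 'm)) \<times> (real^'n^'m)) atlas" where
  "J1 E = {plane_chart E c G | c G. c \<in> E \<and> invertible G}"

definition J1_lift ::
    "('a, 'v::euclidean_space) atlas \<Rightarrow> ('b, 'v) atlas \<Rightarrow> ('a \<Rightarrow> 'b) \<Rightarrow>
     'a \<times> ('a, 'v) tvec set \<Rightarrow> 'b \<times> ('b, 'v) tvec set" where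
  "J1_lift E E' f = (\<lambda>(p, W). (f p, tangent_map E E' f p ` W))"

type_synonym ('a, 'n, 'm) J1_lifting =
  "('a, real^('n + 'm), 'a \<times> ('a, real^('n + 'm)) tvec set,
    (real^('n + 'm)) \<times> (real^'n^'m)) lift"

end

theory Submission imports Defs
begin

text \<open>A linear connection tells how a tangent vector \<open>\<eta>\<close> at p must move when p moves with velocity
  \<open>\<xi>\<close> in order to stay horizontal: in a chart it has the velocity \<open>A \<eta>\<close>, where the matrix A is linear
  in \<open>\<xi>\<close>. As A acts linearly, all vectors of an n-plane W at p move together, so that W itself moves
  with a well-defined velocity. This velocity, together with \<open>\<xi>\<close>, is the horizontal lift of \<open>\<xi>\<close> at W.

  Let W be, after a change of basis G, the graph of a linear map Y from the first n to the last m
  coordinates. Write P(Y) for the block column with blocks 1 and Y and Q(Y) for the block row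
  with blocks -Y and 1; the graph is the range of P(Y) and the kernel of Q(Y). The first-order motion by
  B = G A G^(-1) of a graph changes its slope Y with the velocity Q(Y) B P(Y), a quadratic polynomial in Y
  (\<open>plane_velocity\<close>).

  It must be shown that these coordinate expressions fit together under changes of charts, and that
  they are respected by local diffeomorphisms f. Both are one statement, \<open>plane_lift_transform\<close>,
  because a change of charts is the coordinate expression of f = identity. Let J(x) be the
  Jacobian matrix of f in charts. The two connections on the tangent bundles are related by
  \<open>(x, v) \<mapsto> (f x, J(x) v)\<close>, and evaluating its derivative on a horizontal vector gives
  A' J = J' + J A, where J' is the derivative of J in the direction of \<open>\<xi>\<close>
  (\<open>connection_matrix_transform\<close>). On slopes f acts by \<open>Y \<mapsto> S\<close> where M = G' J G^(-1) maps the graph of Y onto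
  the graph of S, that is, Q(S) M P(Y) = 0. Differentiating this relation and inserting the law for A'
  shows that the velocity Q(Y) B P(Y) is mapped to Q(S) B' P(S)
  (\<open>has_derivative_slope_map\<close>, \<open>slope_velocity_transform\<close>).

  The lift is linear in \<open>\<xi>\<close> because A is, and it is smooth because it is a polynomial in Y whose
  coefficients are coefficients of the given connection.\<close>

section \<open>Calculus of functions of class C^k\<close>

lemma Ck_on_cong:
  assumes "open S" "\<And>x. x \<in> S \<Longrightarrow> f x = g x" "Ck_on k S f"
  shows "Ck_on k S g"
  using assms(2,3)
proof (induction k arbitrary: f g)
  case 0
  then show ?case using continuous_on_cong[of S S f g] by simp
next
  case (Suc k)
  have der: "(g has_derivative frechet_derivative f (at x)) (at x)" if "x \<in> S" for x
    using has_derivative_transform_within_open[OF _ assms(1) that Suc.prems(1)] Suc.prems(2) that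
    by (simp add: frechet_derivative_works)
  have "frechet_derivative g (at x) = frechet_derivative f (at x)" if "x \<in> S" for x
    using frechet_derivative_at[OF der[OF that]] by simp
  then have "Ck_on k S (\<lambda>x. frechet_derivative g (at x) v)" for v
    using Suc.IH[of "\<lambda>x. frechet_derivative f (at x) v"] Suc.prems(2) by simp
  with der show ?case by (auto simp: differentiable_def)
qed

text \<open>A derivative that is only known on the open set S suffices, although \<^const>\<open>Ck_on\<close> refers to
  the total function \<^const>\<open>frechet_derivative\<close>.\<close>

lemma Ck_on_SucI:
  assumes "open S" "\<And>x. x \<in> S \<Longrightarrow> (f has_derivative f' x) (at x)" "\<And>v. Ck_on k S (\<lambda>x. f' x v)"
  shows "Ck_on (Suc k) S f"
proof -
  have "frechet_derivative f (at x) = f' x" if "x \<in> S" for x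
    using frechet_derivative_at[OF assms(2)[OF that]] by simp
  then have "Ck_on k S (\<lambda>x. frechet_derivative f (at x) v)" for v
    using Ck_on_cong[OF assms(1) _ assms(3)] by simp
  then show ?thesis using assms(2) by (auto simp: differentiable_def)
qed

lemma Ck_on_Suc_derivative:
  assumes "Ck_on (Suc k) S f" "x \<in> S"
  shows "(f has_derivative frechet_derivative f (at x)) (at x)"
  using assms by (simp add: frechet_derivative_works)

lemma Ck_on_Suc_imp:
  assumes "Ck_on (Suc k) S f" shows "Ck_on k S f"
  using assms
proof (induction k arbitrary: f)
  case 0
  then show ?case
    by (auto intro!: continuous_at_imp_continuous_on differentiable_imp_continuous_within)
next
  case (Suc k)
  then show ?case by (meson Ck_on.simps(2))
qed

lemma Ck_on_local:
  assumes "\<And>x. x \<in> S \<Longrightarrow> \<exists>T. open T \<and> x \<in> T \<and> Ck_on k T f"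
  shows "Ck_on k S f"
  using assms
proof (induction k arbitrary: f)
  case 0
  then show ?case
    by (metis Ck_on.simps(1) continuous_at_imp_continuous_on continuous_on_eq_continuous_at)
next
  case (Suc k)
  then show ?case by simp metis
qed

lemma Ck_on_const: "Ck_on k S (\<lambda>x. c)"
  by (induction k arbitrary: c) auto

lemma Ck_on_linear_left:
  assumes "open S" "linear L" "Ck_on k S f"
  shows "Ck_on k S (\<lambda>x. L (f x))"
  using assms(3)
proof (induction k arbitrary: f)
  case 0
  then show ?case using linear_continuous_on_compose[OF _ assms(2)] by simp
next
  case (Suc k)
  show ?case
  proof (rule Ck_on_SucI[OF assms(1)])
    show "((\<lambda>x. L (f x)) has_derivative (\<lambda>v. L (frechet_derivative f (at x) v))) (at x)"
      if "x \<in> S" for x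
      using bounded_linear.has_derivative[OF linear_conv_bounded_linear[THEN iffD1, OF assms(2)]]
        Ck_on_Suc_derivative[OF Suc.prems that] by blast
    show "Ck_on k S (\<lambda>x. L (frechet_derivative f (at x) v))" for v
      using Suc by simp
  qed
qed

lemma Ck_on_affine_right:
  fixes L :: "'a::euclidean_space \<Rightarrow> 'b::euclidean_space"
  assumes "open S" "linear L" "\<And>x. x \<in> S \<Longrightarrow> L x + a \<in> T" "Ck_on k T f"
  shows "Ck_on k S (\<lambda>x. f (L x + a))"
  using assms(4)
proof (induction k arbitrary: f)
  case 0
  have "continuous_on S (\<lambda>x. L x + a)"
    by (intro continuous_intros linear_continuous_on linear_conv_bounded_linear[THEN iffD1] assms)
  then show ?case using 0 assms(3) by (auto intro!: continuous_on_compose2[of T f])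
next
  case (Suc k)
  show ?case
  proof (rule Ck_on_SucI[OF assms(1)])
    have "((\<lambda>x. L x + a) has_derivative L) (at x)" for x
      using linear_conv_bounded_linear[THEN iffD1, OF assms(2)]
      by (auto intro!: derivative_eq_intros bounded_linear_imp_has_derivative)
    then show "((\<lambda>x. f (L x + a)) has_derivative (\<lambda>v. frechet_derivative f (at (L x + a)) (L v)))
        (at x)" if "x \<in> S" for x
      using has_derivative_compose[of "\<lambda>x. L x + a"] Ck_on_Suc_derivative[OF Suc.prems]
        assms(3)[OF that] by blast
    show "Ck_on k S (\<lambda>x. frechet_derivative f (at (L x + a)) (L v))" for v
      using Suc.IH[of "\<lambda>y. frechet_derivative f (at y) (L v)"] Suc.prems by simp
  qed
qed

lemma Ck_on_linear: "open S \<Longrightarrow> linear L \<Longrightarrow> Ck_on k S L"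
proof (induction k)
  case 0
  then show ?case by (simp add: linear_continuous_on linear_conv_bounded_linear)
next
  case (Suc k)
  show ?case
    using Suc.prems
    by (intro Ck_on_SucI[of _ _ "\<lambda>_. L"] Ck_on_const)
      (auto intro: bounded_linear_imp_has_derivative simp: linear_conv_bounded_linear)
qed

lemma Ck_on_add:
  assumes "open S" "Ck_on k S f" "Ck_on k S g"
  shows "Ck_on k S (\<lambda>x. f x + g x)"
  using assms(2,3)
proof (induction k arbitrary: f g)
  case 0
  then show ?case by (simp add: continuous_on_add)
next
  case (Suc k)
  show ?case
    by (rule Ck_on_SucI[OF assms(1) has_derivative_add[OF
            Ck_on_Suc_derivative[OF Suc.prems(1)] Ck_on_Suc_derivative[OF Suc.prems(2)]]])
      (use Suc in auto)
qed

lemma Ck_on_sum: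
  assumes "open S" "\<And>i. i \<in> I \<Longrightarrow> Ck_on k S (f i)"
  shows "Ck_on k S (\<lambda>x. \<Sum>i\<in>I. f i x)"
  using assms(2)
  by (induction I rule: infinite_finite_induct) (auto intro: Ck_on_const Ck_on_add[OF assms(1)])

lemma Ck_on_bilinear:
  assumes "open S" "bounded_bilinear B" "Ck_on k S f" "Ck_on k S g"
  shows "Ck_on k S (\<lambda>x. B (f x) (g x))"
  using assms(3,4)
proof (induction k arbitrary: f g)
  case 0
  then show ?case by (simp add: bounded_bilinear.continuous_on[OF assms(2)])
next
  case (Suc k)
  show ?case
  proof (rule Ck_on_SucI[OF assms(1) bounded_bilinear.FDERIV[OF assms(2)
            Ck_on_Suc_derivative[OF Suc.prems(1)] Ck_on_Suc_derivative[OF Suc.prems(2)]]])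
    show "Ck_on k S (\<lambda>x. B (f x) (frechet_derivative g (at x) v) +
        B (frechet_derivative f (at x) v) (g x))" for v
      using Suc.prems Suc.prems[THEN Ck_on_Suc_imp] by (intro Ck_on_add[OF assms(1)] Suc.IH) simp_all
  qed auto
qed

lemma Ck_on_Pair:
  assumes "open S" "Ck_on k S f" "Ck_on k S g"
  shows "Ck_on k S (\<lambda>x. (f x, g x))"
proof -
  have "Ck_on k S (\<lambda>x. (f x, 0) + (0, g x))"
    using assms
    by (intro Ck_on_add) (auto intro!: Ck_on_linear_left[of S "\<lambda>y. (y, 0)"]
        Ck_on_linear_left[of S "\<lambda>y. (0, y)"] linearI)
  then show ?thesis by simp
qed

section \<open>Action of matrices on graphs of linear maps\<close>

lemma matrix_add_rdistrib: "(B + C) ** A = B ** A + C ** (A :: real^'c^'b)"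
  by (simp add: matrix_eq matrix_vector_mul_assoc[symmetric] matrix_vector_mult_add_rdistrib)

lemma
  fixes A :: "real^'k^'k"
  assumes "invertible A"
  shows matrix_inv_right: "A ** matrix_inv A = mat 1" and matrix_inv_left: "matrix_inv A ** A = mat 1"
  using someI_ex[OF assms[unfolded invertible_def]] unfolding matrix_inv_def by auto

lemma bounded_bilinear_matrix_mult:
  "bounded_bilinear ((**) :: real^'b^'a \<Rightarrow> real^'c^'b \<Rightarrow> real^'c^'a)"
  by (intro bilinear_conv_bounded_bilinear[THEN iffD1])
    (auto simp: bilinear_def matrix_add_ldistrib matrix_add_rdistrib
      matrix_scalar_ac scalar_matrix_assoc[symmetric] intro!: linearI)

lemma bounded_bilinear_matrix_vector:
  "bounded_bilinear ((*v) :: real^'b^'a \<Rightarrow> real^'b \<Rightarrow> real^'a)"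
  by (intro bilinear_conv_bounded_bilinear[THEN iffD1])
    (auto simp: bilinear_def matrix_vector_right_distrib matrix_vector_mult_add_rdistrib
      scaleR_matrix_vector_assoc matrix_vector_mult_scaleR intro!: linearI)

lemma tendsto_det:
  fixes K :: "'z \<Rightarrow> real^'k^'k"
  assumes "(K \<longlongrightarrow> A) F"
  shows "((\<lambda>z. det (K z)) \<longlongrightarrow> det A) F"
  unfolding det_def by (intro tendsto_intros assms)

text \<open>The entries of the inverse are quotients of determinants by Cramer's rule, and determinants are
  continuous as polynomials in the entries.\<close>

lemma tendsto_matrix_inv:
  fixes K :: "'z \<Rightarrow> real^'k^'k"
  assumes "(K \<longlongrightarrow> A) F" "invertible A"
  shows "((\<lambda>z. matrix_inv (K z)) \<longlongrightarrow> matrix_inv A) F"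
proof -
  \<comment> \<open>Column j is the solution z of \<open>B *v z = axis j 1\<close>.\<close>
  define C :: "real^'k^'k \<Rightarrow> real^'k^'k" where
    "C B = (\<chi> i j. det (\<chi> a b. if b = i then axis j 1 $ a else B $ a $ b) / det B)" for B
  have C: "C B = matrix_inv B" if B: "invertible B" for B
  proof -
    have "B *v column j (C B) = axis j 1" for j
      using cramer[of B "column j (C B)" "axis j 1"] B
      by (simp add: invertible_det_nz C_def column_def)
    then have "B ** C B = mat 1"
      by (simp add: matrix_eq matrix_vector_mul_assoc[symmetric] vec_eq_iff column_def axis_def
          matrix_matrix_mult_def matrix_vector_mult_def mat_def)
    then show ?thesis
      by (metis B matrix_inv_left matrix_mul_assoc matrix_mul_lid matrix_mul_rid)
  qed
  have "((\<lambda>z. C (K z)) \<longlongrightarrow> C A) F"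
    unfolding C_def
  proof (intro vec_tendstoI, simp only: vec_lambda_beta,
      intro tendsto_divide tendsto_det assms(1))
    show "((\<lambda>z. \<chi> a b. if b = i then axis j 1 $ a else K z $ a $ b) \<longlongrightarrow>
        (\<chi> a b. if b = i then axis j 1 $ a else A $ a $ b)) F" for i j
    proof (intro vec_tendstoI, simp only: vec_lambda_beta)
      show "((\<lambda>z. if b = i then axis j 1 $ a else K z $ a $ b) \<longlongrightarrow>
          (if b = i then axis j 1 $ a else A $ a $ b)) F" for a b
        using tendsto_vec_nth[OF tendsto_vec_nth[OF assms(1)]] by (cases "b = i") simp_all
    qed
    show "det A \<noteq> 0" using assms(2) by (simp add: invertible_det_nz)
  qed
  moreover have "eventually (\<lambda>z. invertible (K z)) F"
    using tendsto_imp_eventually_ne[OF tendsto_det[OF assms(1)]] assms(2)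
    by (simp add: invertible_det_nz)
  ultimately show ?thesis
    using C assms(2) by (auto intro: Lim_transform_eventually elim!: eventually_mono)
qed

text \<open>A product rule in which the factor g need only have a limit at x: as u vanishes at x, the difference
  between g and its limit contributes a term of higher order. With g the inverse of a matrix this avoids differentiating
  the inverse.\<close>

lemma has_derivative_bilinear_vanishing:
  fixes u :: "'z::real_normed_vector \<Rightarrow> 'a::real_normed_vector"
  assumes B: "bounded_bilinear B" and u: "(u has_derivative u') (at x)" "u x = 0"
    and g: "(g \<longlongrightarrow> l) (at x)"
  shows "((\<lambda>z. B (u z) (g z)) has_derivative (\<lambda>h. B (u' h) l)) (at x)"
  unfolding has_derivative_within
proof
  interpret B: bounded_bilinear B by fact
  interpret u': bounded_linear u' using u(1) by (rule has_derivative_bounded_linear)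
  show "bounded_linear (\<lambda>h. B (u' h) l)"
    using bounded_linear_compose[OF B.bounded_linear_left u'.bounded_linear_axioms] .
  let ?r = "\<lambda>z. 1 / norm (z - x)"
  have 1: "((\<lambda>z. B (?r z *\<^sub>R (u z - (u x + u' (z - x)))) (g z)) \<longlongrightarrow> B 0 l) (at x)"
    using u(1) unfolding has_derivative_within by (intro B.tendsto g) auto
  obtain C where C: "\<And>h. norm (u' h) \<le> norm h * C" using u'.bounded by blast
  have "Bfun (\<lambda>z. u' (?r z *\<^sub>R (z - x))) (at x)"
  proof (rule BfunI[of _ "\<bar>C\<bar>"], rule always_eventually, rule allI)
    fix z
    have "norm (u' (?r z *\<^sub>R (z - x))) \<le> norm (?r z *\<^sub>R (z - x)) * C" by (rule C)
    also have "\<dots> \<le> \<bar>C\<bar>" by (cases "z = x") auto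
    finally show "norm (u' (?r z *\<^sub>R (z - x))) \<le> \<bar>C\<bar>" .
  qed
  moreover have "Zfun (\<lambda>z. g z - l) (at x)" using g by (simp add: tendsto_Zfun_iff)
  ultimately have "Zfun (\<lambda>z. B (u' (?r z *\<^sub>R (z - x))) (g z - l)) (at x)"
    by (rule B.Bfun_prod_Zfun)
  then have 2: "((\<lambda>z. B (u' (?r z *\<^sub>R (z - x))) (g z - l)) \<longlongrightarrow> 0) (at x)"
    by (simp add: tendsto_Zfun_iff)
  have "?r z *\<^sub>R (B (u z) (g z) - (B (u x) (g x) + B (u' (z - x)) l)) =
      B (?r z *\<^sub>R (u z - (u x + u' (z - x)))) (g z) + B (u' (?r z *\<^sub>R (z - x))) (g z - l)" for z
  proof -
    have "r *\<^sub>R (B p q - B a l) = B (r *\<^sub>R (p - a)) q + B (r *\<^sub>R a) (q - l)" for r p q a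
      by (simp add: B.scaleR_left B.diff_left B.diff_right algebra_simps)
    then show ?thesis by (simp only: u(2) B.zero_left u'.scaleR add_0_left)
  qed
  then show "((\<lambda>z. ?r z *\<^sub>R (B (u z) (g z) - (B (u x) (g x) + B (u' (z - x)) l))) \<longlongrightarrow> 0) (at x)"
    using tendsto_add[OF 1 2] by (simp add: B.zero_left)
qed

definition base_incl :: "real^'n^('n + 'm::finite)" where
  "base_incl = matrix (\<lambda>u. \<chi> k. case k of Inl i \<Rightarrow> u $ i | Inr j \<Rightarrow> 0)"

definition fibre_incl :: "real^'m^('n::finite + 'm)" where
  "fibre_incl = matrix (\<lambda>w. \<chi> k. case k of Inl i \<Rightarrow> 0 | Inr j \<Rightarrow> w $ j)"

definition base_proj :: "real^('n + 'm::finite)^'n" where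
  "base_proj = matrix (\<lambda>z. \<chi> i. z $ Inl i)"

definition fibre_proj :: "real^('n::finite + 'm)^'m" where
  "fibre_proj = matrix (\<lambda>z. \<chi> j. z $ Inr j)"

lemma block_vector:
  "base_incl *v u = (\<chi> k. case k of Inl i \<Rightarrow> u $ i | Inr j \<Rightarrow> 0)"
  "fibre_incl *v w = (\<chi> k. case k of Inl i \<Rightarrow> 0 | Inr j \<Rightarrow> w $ j)"
  "base_proj *v z = (\<chi> i. z $ Inl i)"
  "fibre_proj *v z = (\<chi> j. z $ Inr j)"
  unfolding base_incl_def fibre_incl_def base_proj_def fibre_proj_def
  by (subst matrix_vector_mul(2), auto intro!: linearI simp: vec_eq_iff split: sum.split)+

lemma block_mult:
  "base_proj ** (base_incl :: real^'n^('n + 'm::finite)) = mat 1"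
  "base_proj ** (fibre_incl :: real^'m^('n + 'm::finite)) = 0"
  "fibre_proj ** (base_incl :: real^'n^('n + 'm::finite)) = 0"
  "fibre_proj ** (fibre_incl :: real^'m^('n::finite + 'm::finite)) = mat 1"
  "base_incl ** base_proj + fibre_incl ** fibre_proj = (mat 1 :: real^('n + 'm::finite)^('n + 'm))"
  by (auto simp: matrix_eq matrix_vector_mul_assoc[symmetric] block_vector vec_eq_iff
      matrix_vector_mult_add_rdistrib split: sum.split)

text \<open>The block column with blocks 1 and Y, and the block row with blocks -Y and 1. The graph of Y is the
  range of the first and the kernel of the second.\<close>

definition graph_frame :: "real^'n^'m \<Rightarrow> real^'n^('n + 'm::finite)" where
  "graph_frame Y = base_incl + fibre_incl ** Y"

definition graph_conormal :: "real^'n^'m \<Rightarrow> real^('n::finite + 'm)^'m" where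
  "graph_conormal Y = fibre_proj - Y ** base_proj"

lemma base_proj_frame: "base_proj ** graph_frame Y = mat 1"
  by (simp add: graph_frame_def matrix_add_ldistrib matrix_mul_assoc block_mult)

lemma fibre_proj_frame: "fibre_proj ** graph_frame Y = Y"
  by (simp add: graph_frame_def matrix_add_ldistrib matrix_mul_assoc block_mult)

lemma matrix_diff_ldistrib: "A ** (B - C) = A ** B - A ** (C :: real^'c^'b)"
  by (rule bounded_bilinear.diff_right[OF bounded_bilinear_matrix_mult])

lemma matrix_diff_rdistrib: "(B - C) ** A = B ** A - C ** (A :: real^'c^'b)"
  by (rule bounded_bilinear.diff_left[OF bounded_bilinear_matrix_mult])

lemma conormal_frame: "graph_conormal Y ** graph_frame Y = 0"
  by (simp add: graph_conormal_def matrix_diff_rdistrib fibre_proj_frame base_proj_frame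
      matrix_mul_assoc[symmetric])

text \<open>A vector is the sum of the point of the graph with the same base component and of a vertical vector;
  the conormal measures the latter.\<close>

lemma frame_conormal_decomp: "fibre_incl ** graph_conormal Y + graph_frame Y ** base_proj = mat 1"
  unfolding block_mult(5)[symmetric]
  by (simp add: graph_conormal_def graph_frame_def matrix_diff_ldistrib matrix_add_rdistrib
      matrix_mul_assoc)

lemma graph_plane_eq_range: "graph_plane Y = range ((*v) (graph_frame Y))"
proof (intro set_eqI iffI)
  fix z assume "z \<in> graph_plane Y"
  then have "fibre_proj *v z = Y *v (base_proj *v z)" by (simp add: graph_plane_def block_vector)
  then have "graph_conormal Y *v z = 0"
    by (simp add: graph_conormal_def matrix_vector_mult_diff_rdistrib matrix_vector_mul_assoc)
  then have "graph_frame Y *v (base_proj *v z) = z"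
    using arg_cong[OF frame_conormal_decomp[of Y], of "\<lambda>M. M *v z"]
    by (simp add: matrix_vector_mult_add_rdistrib matrix_vector_mul_assoc[symmetric])
  then show "z \<in> range ((*v) (graph_frame Y))" by (metis rangeI)
next
  fix z assume "z \<in> range ((*v) (graph_frame Y))"
  then obtain u where "z = graph_frame Y *v u" by auto
  then show "z \<in> graph_plane Y"
    using block_vector(3,4)[of z]
    by (simp add: graph_plane_def matrix_vector_mul_assoc fibre_proj_frame base_proj_frame)
qed

lemma mem_graph_plane_iff: "z \<in> graph_plane Y \<longleftrightarrow> fibre_proj *v z = Y *v (base_proj *v z)"
  by (simp add: graph_plane_def block_vector)

lemma graph_plane_inject: "graph_plane Y = graph_plane Y' \<longleftrightarrow> Y = Y'"
proof
  assume eq: "graph_plane Y = graph_plane Y'"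
  have "Y *v u = Y' *v u" for u
  proof -
    have "graph_frame Y *v u \<in> graph_plane Y'"
      unfolding eq[symmetric] by (simp add: graph_plane_eq_range)
    then show ?thesis
      by (simp add: mem_graph_plane_iff matrix_vector_mul_assoc matrix_mul_assoc[symmetric]
          base_proj_frame fibre_proj_frame)
  qed
  then show "Y = Y'" by (simp add: matrix_eq)
qed simp

lemma the_graph_plane: "(THE Y'. graph_plane Y = graph_plane Y') = Y"
  by (simp add: graph_plane_inject)

lemma graph_plane_subspace: "subspace (graph_plane Y)"
  unfolding graph_plane_eq_range by (metis linear_subspace_image matrix_vector_mul_linear subspace_UNIV)

lemma dim_graph_plane: "dim (graph_plane (Y :: real^'n^'m)) = CARD('n)"
proof -
  have "inj ((*v) (graph_frame Y))"
    by (metis base_proj_frame matrix_left_invertible_injective)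
  then show ?thesis
    unfolding graph_plane_eq_range
    using dim_image_eq[of "(*v) (graph_frame Y)" UNIV] matrix_vector_mul_linear[of "graph_frame Y"]
    by simp
qed

text \<open>The action of M on slopes, a matrix version of a linear fractional transformation: if
  \<open>base_proj ** M ** graph_frame Y\<close> is invertible, then M maps the graph of Y onto a graph again, and
  this is its slope.\<close>

definition slope_map :: "real^('n::finite + 'm::finite)^('n + 'm) \<Rightarrow> real^'n^'m \<Rightarrow> real^'n^'m" where
  "slope_map M Y = (fibre_proj ** M ** graph_frame Y) ** matrix_inv (base_proj ** M ** graph_frame Y)"

text \<open>The columns of \<open>M ** graph_frame Y\<close> and those of the graph frame of the image are two bases of the
  same plane; the right-hand factor is the change of basis.\<close>

lemma frame_slope_map:
  assumes "invertible (base_proj ** M ** graph_frame Y)"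
  shows "M ** graph_frame Y = graph_frame (slope_map M Y) ** (base_proj ** M ** graph_frame Y)"
proof -
  let ?K = "base_proj ** M ** graph_frame Y"
  have "slope_map M Y ** ?K = fibre_proj ** M ** graph_frame Y"
    using assms by (simp add: slope_map_def matrix_mul_assoc[symmetric] matrix_inv_left)
  then have "graph_frame (slope_map M Y) ** ?K =
      (base_incl ** base_proj + fibre_incl ** fibre_proj) ** (M ** graph_frame Y)"
    by (simp add: graph_frame_def[of "slope_map M Y"] matrix_add_rdistrib matrix_mul_assoc[symmetric])
  then show ?thesis by (simp add: block_mult)
qed

lemma image_graph_plane:
  assumes "invertible (base_proj ** M ** graph_frame Y)"
  shows "(*v) M ` graph_plane Y = graph_plane (slope_map M Y)"
proof -
  let ?K = "base_proj ** M ** graph_frame Y"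
  have "range ((*v) ?K) = UNIV"
    using assms by (simp add: invertible_eq_bij bij_is_surj)
  then have "graph_plane (slope_map M Y) = (*v) (graph_frame (slope_map M Y)) ` range ((*v) ?K)"
    by (simp add: graph_plane_eq_range)
  also have "\<dots> = range ((*v) (M ** graph_frame Y))"
    unfolding frame_slope_map[OF assms] by (simp add: image_comp o_def matrix_vector_mul_assoc)
  also have "\<dots> = (*v) M ` graph_plane Y"
    by (simp add: graph_plane_eq_range image_comp o_def matrix_vector_mul_assoc)
  finally show ?thesis by simp
qed

text \<open>Invertibility comes for free if the image is known to be a graph, since the base component maps a
  graph onto the whole base space.\<close>

lemma image_graph_plane_eqD:
  assumes "(*v) M ` graph_plane Y = graph_plane Y'"
  shows "invertible (base_proj ** M ** graph_frame Y)" "slope_map M Y = Y'"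
proof -
  let ?K = "base_proj ** M ** graph_frame Y"
  have "\<exists>w. ?K *v w = u" for u
  proof -
    have "graph_frame Y' *v u \<in> (*v) M ` graph_plane Y"
      unfolding assms by (simp add: graph_plane_eq_range)
    then obtain w where "graph_frame Y' *v u = M *v (graph_frame Y *v w)"
      by (auto simp: graph_plane_eq_range)
    then have "base_proj *v (graph_frame Y' *v u) = ?K *v w"
      by (simp add: matrix_vector_mul_assoc matrix_mul_assoc)
    then show ?thesis by (metis matrix_vector_mul_assoc base_proj_frame matrix_vector_mul_lid)
  qed
  then have "surj ((*v) ?K)" by (metis surj_def)
  then show inv: "invertible ?K"
    by (metis invertible_right_inverse matrix_right_invertible_surjective)
  show "slope_map M Y = Y'"
    using image_graph_plane[OF inv] assms by (simp add: graph_plane_inject)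
qed

text \<open>For S fixed as the value of the slope at z, the slope at x exceeds S by
  \<open>graph_conormal S ** M x ** graph_frame (Y x)\<close> times an inverse matrix. The first factor vanishes at z,
  so that only its derivative enters.\<close>

lemma has_derivative_slope_map:
  fixes M :: "'z::real_normed_vector \<Rightarrow> real^('n::finite + 'm::finite)^('n + 'm)"
  assumes M: "(M has_derivative M') (at z)" and Y: "(Y has_derivative Y') (at z)"
    and inv: "invertible (base_proj ** M z ** graph_frame (Y z))"
  shows "((\<lambda>z. slope_map (M z) (Y z)) has_derivative
    (\<lambda>h. graph_conormal (slope_map (M z) (Y z)) ** (M' h ** graph_frame (Y z) + M z ** (fibre_incl ** Y' h))
      ** matrix_inv (base_proj ** M z ** graph_frame (Y z)))) (at z)"
proof -
  note mm = bounded_bilinear_matrix_mult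
  let ?K = "\<lambda>z. base_proj ** M z ** graph_frame (Y z)" and ?S = "slope_map (M z) (Y z)"
  let ?V = "\<lambda>z. M z ** graph_frame (Y z)"
  have frame: "((\<lambda>z. graph_frame (Y z)) has_derivative (\<lambda>h. fibre_incl ** Y' h)) (at z)"
    unfolding graph_frame_def
    using has_derivative_add[OF has_derivative_const bounded_linear.has_derivative[OF
          bounded_bilinear.bounded_linear_right[OF mm] Y]] by simp
  have V: "(?V has_derivative (\<lambda>h. M z ** (fibre_incl ** Y' h) + M' h ** graph_frame (Y z))) (at z)"
    by (rule bounded_bilinear.FDERIV[OF mm M frame])
  have u: "((\<lambda>x. graph_conormal ?S ** ?V x) has_derivative
      (\<lambda>h. graph_conormal ?S ** (M z ** (fibre_incl ** Y' h) + M' h ** graph_frame (Y z)))) (at z)"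
    by (rule bounded_linear.has_derivative[OF bounded_bilinear.bounded_linear_right[OF mm] V])
  have u0: "graph_conormal ?S ** ?V z = 0"
    by (simp add: frame_slope_map[OF inv] matrix_mul_assoc conormal_frame)
  have "((\<lambda>x. base_proj ** ?V x) \<longlongrightarrow> base_proj ** ?V z) (at z)"
    using has_derivative_continuous[OF bounded_linear.has_derivative[OF
          bounded_bilinear.bounded_linear_right[OF mm] V]]
    by (simp add: continuous_within)
  then have K: "(?K \<longlongrightarrow> ?K z) (at z)" by (simp add: matrix_mul_assoc)
  have "eventually (\<lambda>x. invertible (?K x)) (at z)"
    using tendsto_imp_eventually_ne[OF tendsto_det[OF K]] inv by (simp add: invertible_det_nz)
  moreover have "slope_map (M x) (Y x) = graph_conormal ?S ** ?V x ** matrix_inv (?K x) + ?S"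
    if "invertible (?K x)" for x
  proof -
    have "graph_conormal ?S ** ?V x = slope_map (M x) (Y x) ** ?K x - ?S ** ?K x"
    proof -
      have "graph_conormal ?S ** graph_frame (slope_map (M x) (Y x)) = slope_map (M x) (Y x) - ?S"
        by (simp add: graph_conormal_def matrix_diff_rdistrib fibre_proj_frame base_proj_frame
            matrix_mul_assoc[symmetric])
      then show ?thesis
        by (simp add: frame_slope_map[OF that] matrix_mul_assoc matrix_diff_rdistrib)
    qed
    then have "graph_conormal ?S ** ?V x ** matrix_inv (?K x) =
        slope_map (M x) (Y x) ** (?K x ** matrix_inv (?K x)) - ?S ** (?K x ** matrix_inv (?K x))"
      by (simp add: matrix_diff_rdistrib matrix_mul_assoc)
    then show ?thesis by (simp add: matrix_inv_right[OF that])
  qed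
  ultimately have ev: "eventually (\<lambda>x. graph_conormal ?S ** ?V x ** matrix_inv (?K x) + ?S =
      slope_map (M x) (Y x)) (at z)"
    by (auto elim: eventually_mono)
  have "((\<lambda>x. graph_conormal ?S ** ?V x ** matrix_inv (?K x) + ?S) has_derivative
      (\<lambda>h. graph_conormal ?S ** (M z ** (fibre_incl ** Y' h) + M' h ** graph_frame (Y z))
        ** matrix_inv (?K z))) (at z)"
    using has_derivative_add[OF has_derivative_bilinear_vanishing[OF mm u u0
          tendsto_matrix_inv[OF K inv]] has_derivative_const[of ?S]] by simp
  then show ?thesis
    using has_derivative_transform_eventually[OF _ ev] u0 by (simp add: add.commute)
qed

text \<open>The left-hand side is the derivative of the slope from the previous lemma in the direction
  \<open>(M', graph_conormal Y ** B ** graph_frame Y)\<close>. Replacing \<open>fibre_incl ** graph_conormal Y\<close> by the identity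
  minus a term that M maps into the image graph, which the conormal kills, turns it into
  \<open>graph_conormal S ** (M' + M ** B) ** graph_frame Y\<close>, and the law rewrites the bracket.\<close>

lemma slope_velocity_transform:
  assumes inv: "invertible (base_proj ** M ** graph_frame Y)"
    and law: "B' ** M = M' + M ** B"
  shows "graph_conormal (slope_map M Y) ** (M' ** graph_frame Y +
        M ** (fibre_incl ** (graph_conormal Y ** B ** graph_frame Y)))
      ** matrix_inv (base_proj ** M ** graph_frame Y) =
    graph_conormal (slope_map M Y) ** B' ** graph_frame (slope_map M Y)"
proof -
  let ?K = "base_proj ** M ** graph_frame Y" and ?S = "slope_map M Y"
  have *: "fibre_incl ** graph_conormal Y = mat 1 - graph_frame Y ** base_proj"
    using frame_conormal_decomp[of Y] by (simp add: eq_diff_eq)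
  have "M ** (fibre_incl ** (graph_conormal Y ** B ** graph_frame Y)) =
      M ** (fibre_incl ** graph_conormal Y) ** B ** graph_frame Y"
    by (simp add: matrix_mul_assoc)
  also have "\<dots> = M ** B ** graph_frame Y - M ** graph_frame Y ** (base_proj ** B ** graph_frame Y)"
    unfolding * by (simp add: matrix_diff_ldistrib matrix_diff_rdistrib matrix_mul_assoc)
  finally have "M' ** graph_frame Y + M ** (fibre_incl ** (graph_conormal Y ** B ** graph_frame Y)) =
      B' ** M ** graph_frame Y - M ** graph_frame Y ** (base_proj ** B ** graph_frame Y)"
    unfolding law by (simp add: matrix_add_rdistrib)
  moreover have "graph_conormal ?S ** (M ** graph_frame Y) = 0"
    by (simp add: frame_slope_map[OF inv] matrix_mul_assoc conormal_frame)
  ultimately have "graph_conormal ?S ** (M' ** graph_frame Y +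
        M ** (fibre_incl ** (graph_conormal Y ** B ** graph_frame Y))) =
      graph_conormal ?S ** (B' ** (M ** graph_frame Y))"
    by (simp add: matrix_diff_ldistrib matrix_mul_assoc)
  also have "\<dots> = graph_conormal ?S ** B' ** graph_frame ?S ** ?K"
    by (simp add: frame_slope_map[OF inv] matrix_mul_assoc)
  finally show ?thesis
    using matrix_inv_right[OF inv] by (simp add: matrix_mul_assoc[symmetric])
qed

section \<open>Smooth maps and tangent vectors\<close>

lemma charts_atD: "c \<in> charts_at A p \<Longrightarrow> c \<in> A" "c \<in> charts_at A p \<Longrightarrow> p \<in> fst c"
  by (auto simp: charts_at_def)

lemma chart_inv_chart: "inj_on (snd c) (fst c) \<Longrightarrow> p \<in> fst c \<Longrightarrow> chart_inv c (snd c p) = p"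
  by (simp add: chart_inv_def)

lemma chart_inv_image:
  "x \<in> snd c ` S \<Longrightarrow> S \<subseteq> fst c \<Longrightarrow> inj_on (snd c) (fst c) \<Longrightarrow>
    chart_inv c x \<in> S \<and> snd c (chart_inv c x) = x"
  by (auto simp: chart_inv_chart subset_iff)

lemma jacobian_works:
  "local_rep c d f differentiable (at (snd c p)) \<Longrightarrow>
    (local_rep c d f has_derivative jacobian c d f p) (at (snd c p))"
  unfolding jacobian_def by (simp add: frechet_derivative_works)

lemma jacobianI:
  "(local_rep c d f has_derivative D) (at (snd c p)) \<Longrightarrow> jacobian c d f p = D"
  unfolding jacobian_def by (rule frechet_derivative_at[symmetric])

lemma has_derivative_eventually_eq:
  assumes "(f has_derivative D) (at x)" "\<forall>\<^sub>F y in nhds x. f y = g y"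
  shows "(g has_derivative D) (at x)"
proof -
  obtain S where "open S" "x \<in> S" "\<And>y. y \<in> S \<Longrightarrow> f y = g y"
    using assms(2) unfolding eventually_nhds by blast
  then show ?thesis using has_derivative_transform_within_open[OF assms(1)] by blast
qed

text \<open>The local representatives need only be differentiable at the relevant points, so that the rule also
  applies to maps between tangent bundles.\<close>

lemma jacobian_compose:
  assumes "inj_on (snd c) (fst c)" "p \<in> fst c" "inj_on (snd d) (fst d)"
    and ev: "\<forall>\<^sub>F x in nhds (snd c p). f (chart_inv c x) \<in> fst d"
    and f: "local_rep c d f differentiable (at (snd c p))"
    and g: "local_rep d e g differentiable (at (snd d (f p)))"
  shows "jacobian c e (\<lambda>q. g (f q)) p v = jacobian d e g (f p) (jacobian c d f p v)"
proof -
  have "local_rep c d f (snd c p) = snd d (f p)"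
    using assms(1,2) by (simp add: local_rep_def chart_inv_chart)
  then have comp: "((\<lambda>x. local_rep d e g (local_rep c d f x)) has_derivative
      (\<lambda>v. jacobian d e g (f p) (jacobian c d f p v))) (at (snd c p))"
    by (intro has_derivative_compose[OF jacobian_works[OF f]]) (simp add: jacobian_works[OF g])
  have *: "\<forall>\<^sub>F x in nhds (snd c p). local_rep d e g (local_rep c d f x) = local_rep c e (\<lambda>q. g (f q)) x"
    using ev by eventually_elim (simp add: local_rep_def chart_inv_chart[OF assms(3)])
  have "(local_rep c e (\<lambda>q. g (f q)) has_derivative
      (\<lambda>v. jacobian d e g (f p) (jacobian c d f p v))) (at (snd c p))"
    by (rule has_derivative_eventually_eq[OF comp *])
  then show ?thesis by (simp add: jacobianI)
qed

lemma smooth_manifold_chart: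
  assumes "smooth_manifold E" "c \<in> E"
  shows "inj_on (snd c) (fst c)" "open (snd c ` fst c)"
  using assms by (auto simp: smooth_manifold_def)

lemma smooth_map_ident:
  assumes "smooth_manifold E" shows "smooth_map E E (\<lambda>p. p)"
  using assms by (auto simp: smooth_manifold_def smooth_map_def Int_def)

lemma smooth_map_chart:
  assumes "smooth_map A B f" "c \<in> charts_at A p" "d \<in> charts_at B (f p)"
  shows "open (snd c ` {q \<in> fst c. f q \<in> fst d})"
    and "smooth_on (snd c ` {q \<in> fst c. f q \<in> fst d}) (local_rep c d f)"
    and "snd c p \<in> snd c ` {q \<in> fst c. f q \<in> fst d}"
  using assms by (auto simp: smooth_map_def charts_at_def)

lemma smooth_on_differentiable:
  assumes "smooth_on S f" "x \<in> S" shows "f differentiable (at x)"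
proof -
  have "Ck_on (Suc 0) S f" using assms(1) by (simp only: smooth_on_def)
  then show ?thesis using assms(2) by simp
qed

lemma smooth_on_derivative:
  assumes "smooth_on S f" shows "smooth_on S (\<lambda>x. frechet_derivative f (at x) v)"
  unfolding smooth_on_def
proof
  fix k
  have "Ck_on (Suc k) S f" using assms by (simp only: smooth_on_def)
  then show "Ck_on k S (\<lambda>x. frechet_derivative f (at x) v)" by simp
qed

lemma smooth_map_differentiable:
  assumes "smooth_map A B f" "c \<in> charts_at A p" "d \<in> charts_at B (f p)"
  shows "local_rep c d f differentiable (at (snd c p))"
  using smooth_on_differentiable smooth_map_chart[OF assms] by blast

lemma linear_jacobian:
  assumes "smooth_map A B f" "c \<in> charts_at A p" "d \<in> charts_at B (f p)"
  shows "linear (jacobian c d f p)"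
  unfolding jacobian_def by (rule linear_frechet_derivative[OF smooth_map_differentiable[OF assms]])

lemma smooth_map_eventually:
  assumes "inj_on (snd c) (fst c)" "smooth_map A B f" "c \<in> charts_at A p" "d \<in> charts_at B (f p)"
  shows "\<forall>\<^sub>F x in nhds (snd c p). chart_inv c x \<in> fst c \<and> f (chart_inv c x) \<in> fst d \<and>
    snd c (chart_inv c x) = x"
proof -
  let ?S = "{q \<in> fst c. f q \<in> fst d}"
  have "\<forall>\<^sub>F x in nhds (snd c p). x \<in> snd c ` ?S"
    using smooth_map_chart(1,3)[OF assms(2-4)] by (rule eventually_nhds_in_open)
  then show ?thesis
  proof eventually_elim
    case (elim x)
    show ?case using chart_inv_image[OF elim _ assms(1)] by auto
  qed
qed

lemma smooth_map_chain:
  assumes "smooth_manifold A" "smooth_manifold B" "smooth_map A B f" "smooth_map B C g"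
    and "c \<in> charts_at A p" "d \<in> charts_at B (f p)" "e \<in> charts_at C (g (f p))"
  shows "jacobian c e (\<lambda>q. g (f q)) p v = jacobian d e g (f p) (jacobian c d f p v)"
proof (rule jacobian_compose)
  show inj: "inj_on (snd c) (fst c)" "inj_on (snd d) (fst d)" and "p \<in> fst c"
    using assms by (auto simp: smooth_manifold_def charts_at_def)
  show "\<forall>\<^sub>F x in nhds (snd c p). f (chart_inv c x) \<in> fst d"
    using smooth_map_eventually[OF inj(1) assms(3,5,6)] by (rule eventually_mono) auto
qed (use assms in \<open>auto intro: smooth_map_differentiable\<close>)

lemma jacobian_ident:
  assumes "inj_on (snd c) (fst c)" "open (snd c ` fst c)" "p \<in> fst c"
  shows "jacobian c c (\<lambda>q. q) p v = v"
proof -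
  have "(local_rep c c (\<lambda>q. q) has_derivative (\<lambda>v. v)) (at (snd c p))"
    by (rule has_derivative_transform_within_open[OF has_derivative_ident assms(2)])
      (use assms in \<open>auto simp: local_rep_def chart_inv_chart\<close>)
  then show ?thesis by (simp add: jacobianI)
qed

lemma tangent_spaceI:
  assumes "\<And>c. c \<notin> charts_at A p \<Longrightarrow> \<xi> c = 0"
    and "\<And>c d. c \<in> charts_at A p \<Longrightarrow> d \<in> charts_at A p \<Longrightarrow> jacobian c d (\<lambda>q. q) p (\<xi> c) = \<xi> d"
  shows "\<xi> \<in> tangent_space A p"
  unfolding tangent_space_def mem_Collect_eq using assms(1) assms(2)[symmetric] by blast

lemma tangent_space_outside: "\<xi> \<in> tangent_space A p \<Longrightarrow> c \<notin> charts_at A p \<Longrightarrow> \<xi> c = 0"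
  unfolding tangent_space_def mem_Collect_eq by blast

lemma tangent_space_transform:
  assumes "\<xi> \<in> tangent_space A p" "c \<in> charts_at A p" "d \<in> charts_at A p"
  shows "jacobian c d (\<lambda>q. q) p (\<xi> c) = \<xi> d"
proof -
  have "\<xi> d = jacobian c d (\<lambda>q. q) p (\<xi> c)"
    using assms unfolding tangent_space_def mem_Collect_eq by blast
  then show ?thesis by (rule sym)
qed

lemma tvec_of_in_tangent_space:
  assumes "smooth_manifold A" "c \<in> charts_at A p"
  shows "tvec_of A c p v \<in> tangent_space A p"
proof (rule tangent_spaceI)
  note ident = smooth_map_ident[OF assms(1)]
  show "jacobian d e (\<lambda>q. q) p (tvec_of A c p v d) = tvec_of A c p v e"
    if "d \<in> charts_at A p" "e \<in> charts_at A p" for d e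
    using smooth_map_chain[OF assms(1,1) ident ident assms(2) that, of v] that
    by (simp only: tvec_of_def if_True)
qed (simp add: tvec_of_def)

lemma tvec_of_component:
  assumes "smooth_manifold A" "c \<in> charts_at A p"
  shows "tvec_of A c p v c = v"
  using assms jacobian_ident[of c p v] by (simp add: tvec_of_def smooth_manifold_def charts_at_def)

lemma tvec_of_tangent:
  assumes "\<xi> \<in> tangent_space A p" "c \<in> charts_at A p"
  shows "tvec_of A c p (\<xi> c) = \<xi>"
  using tangent_space_transform[OF assms] tangent_space_outside[OF assms(1)]
  by (simp add: tvec_of_def fun_eq_iff)

lemma tvec_of_linear:
  assumes "smooth_manifold A" "c \<in> charts_at A p"
  shows "tvec_of A c p (a *\<^sub>R v + b *\<^sub>R w) = (\<lambda>d. a *\<^sub>R tvec_of A c p v d + b *\<^sub>R tvec_of A c p w d)"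
  using linear_jacobian[OF smooth_map_ident[OF assms(1)] assms(2)]
  by (auto simp: tvec_of_def fun_eq_iff linear_add linear_scale)

lemma tangent_space_linear:
  assumes "smooth_manifold A" "\<xi> \<in> tangent_space A p" "\<eta> \<in> tangent_space A p"
  shows "(\<lambda>c. a *\<^sub>R \<xi> c + b *\<^sub>R \<eta> c) \<in> tangent_space A p"
  using linear_jacobian[OF smooth_map_ident[OF assms(1)]]
  by (intro tangent_spaceI) (simp_all add: tangent_space_outside[OF assms(2)]
      tangent_space_outside[OF assms(3)] linear_add linear_scale
      tangent_space_transform[OF assms(2)] tangent_space_transform[OF assms(3)])

text \<open>The tangent map is defined with an arbitrarily chosen chart; by the chain rule every chart will do.\<close>

lemma tangent_map_component:
  assumes "smooth_manifold A" "smooth_map A B f"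
    and \<xi>: "\<xi> \<in> tangent_space A p" and c: "c \<in> charts_at A p" and d: "d \<in> charts_at B (f p)"
  shows "tangent_map A B f p \<xi> d = jacobian c d f p (\<xi> c)"
proof -
  define c0 where "c0 = (SOME c. c \<in> charts_at A p)"
  have c0: "c0 \<in> charts_at A p" unfolding c0_def using c by (rule someI)
  have "jacobian c0 d f p (\<xi> c0) = jacobian c0 d f p (jacobian c c0 (\<lambda>q. q) p (\<xi> c))"
    by (simp add: tangent_space_transform[OF \<xi> c c0])
  also have "\<dots> = jacobian c d f p (\<xi> c)"
    using smooth_map_chain[OF assms(1,1) smooth_map_ident[OF assms(1)] assms(2) c c0 d] by simp
  finally show ?thesis using d by (simp add: tangent_map_def c0_def[symmetric])
qed

lemma tangent_map_in_tangent_space: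
  assumes "smooth_manifold A" "smooth_manifold B" "smooth_map A B f"
    and \<xi>: "\<xi> \<in> tangent_space A p" and c: "c \<in> charts_at A p"
  shows "tangent_map A B f p \<xi> \<in> tangent_space B (f p)"
proof (rule tangent_spaceI)
  show "jacobian d e (\<lambda>q. q) (f p) (tangent_map A B f p \<xi> d) = tangent_map A B f p \<xi> e"
    if "d \<in> charts_at B (f p)" "e \<in> charts_at B (f p)" for d e
    using smooth_map_chain[OF assms(1-3) smooth_map_ident[OF assms(2)] c that]
    by (simp add: tangent_map_component[OF assms(1,3) \<xi> c] that)
qed (simp add: tangent_map_def)

lemma tangent_map_ident:
  assumes "smooth_manifold A" "\<xi> \<in> tangent_space A p" "c \<in> charts_at A p"
  shows "tangent_map A A (\<lambda>q. q) p \<xi> = \<xi>"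
proof
  fix d
  show "tangent_map A A (\<lambda>q. q) p \<xi> d = \<xi> d"
  proof (cases "d \<in> charts_at A p")
    case True
    then show ?thesis
      using tangent_map_component[OF assms(1) smooth_map_ident[OF assms(1)] assms(2,3), of d]
        tangent_space_transform[OF assms(2,3)] by simp
  qed (simp add: tangent_map_def tangent_space_outside[OF assms(2)])
qed

text \<open>Smoothness is local, and the charts of a restricted atlas have the same local representatives near
  each point.\<close>

lemma local_diffeomorphism_imp_smooth_map:
  assumes A: "smooth_manifold A" and B: "smooth_manifold B" and f: "local_diffeomorphism A B f"
  shows "smooth_map A B f"
  unfolding smooth_map_def
proof (intro conjI ballI)
  have openB: "openin (atlas_topology B) T \<Longrightarrow> T \<subseteq> points B" for T
    using openin_atlas_topology[of B T] B by (simp add: smooth_manifold_def)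
  show "f ` points A \<subseteq> points B"
    using f openB unfolding local_diffeomorphism_def by blast
  fix c d assume c: "c \<in> A" and d: "d \<in> B"
  let ?O = "snd c ` {p \<in> fst c. f p \<in> fst d}"
  have inj: "inj_on (snd c) (fst c)" using A c by (simp add: smooth_manifold_def)
  have loc: "\<exists>T. open T \<and> x \<in> T \<and> T \<subseteq> ?O \<and> smooth_on T (local_rep c d f)" if "x \<in> ?O" for x
  proof -
    obtain p where p: "p \<in> fst c" "f p \<in> fst d" "x = snd c p" using \<open>x \<in> ?O\<close> by auto
    then have "p \<in> points A" using c by (auto simp: points_def)
    then obtain S where S: "p \<in> S"
        "diffeomorphism (restrict_atlas A S) (restrict_atlas B (f ` S)) f"
      using f unfolding local_diffeomorphism_def by blast
    let ?c = "(fst c \<inter> S, snd c)" and ?d = "(fst d \<inter> f ` S, snd d)"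
    let ?T = "snd c ` {q \<in> fst c \<inter> S. f q \<in> fst d}"
    have cd: "?c \<in> restrict_atlas A S" "?d \<in> restrict_atlas B (f ` S)"
      using c d by (auto simp: restrict_atlas_def)
    have "smooth_map (restrict_atlas A S) (restrict_atlas B (f ` S)) f"
      using S(2) unfolding diffeomorphism_def by (elim conjE)
    then have "\<forall>c\<in>restrict_atlas A S. \<forall>d\<in>restrict_atlas B (f ` S).
        open (snd c ` {p \<in> fst c. f p \<in> fst d}) \<and>
        smooth_on (snd c ` {p \<in> fst c. f p \<in> fst d}) (local_rep c d f)"
      unfolding smooth_map_def by (elim conjE)
    from bspec[OF bspec[OF this cd(1)] cd(2)]
    have "open (snd ?c ` {q \<in> fst ?c. f q \<in> fst ?d})"
        "smooth_on (snd ?c ` {q \<in> fst ?c. f q \<in> fst ?d}) (local_rep ?c ?d f)"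
      by (rule conjunct1, rule conjunct2)
    moreover have "{q \<in> fst ?c. f q \<in> fst ?d} = {q \<in> fst c \<inter> S. f q \<in> fst d}" by auto
    ultimately have T: "open ?T" "smooth_on ?T (local_rep ?c ?d f)" by simp_all
    have "inj_on (snd c) (fst c \<inter> S)" using inj by (rule inj_on_subset) auto
    then have "local_rep ?c ?d f y = local_rep c d f y" if "y \<in> ?T" for y
      using that inj by (auto simp: local_rep_def chart_inv_def)
    then have "smooth_on ?T (local_rep c d f)"
      using Ck_on_cong[OF T(1), of "local_rep ?c ?d f" "local_rep c d f"] T(2)
      by (simp only: smooth_on_def) blast
    then show ?thesis using T p S(1) by (intro exI[of _ ?T]) auto
  qed
  then show "open ?O" by (subst open_subopen) blast
  show "smooth_on ?O (local_rep c d f)"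
    unfolding smooth_on_def
  proof (intro allI Ck_on_local)
    fix k x assume "x \<in> ?O"
    from loc[OF this] show "\<exists>T. open T \<and> x \<in> T \<and> Ck_on k T (local_rep c d f)"
      unfolding smooth_on_def by blast
  qed
qed

section \<open>Linear connections in coordinates\<close>

text \<open>Writing a matrix as a sum of linear images of its columns reduces differentiability and smoothness
  of matrix-valued maps to their values on vectors.\<close>

lemma matrix_column_sum:
  "matrix (f :: real^'k \<Rightarrow> real^'l) = (\<Sum>j\<in>UNIV. (\<chi> i k. if k = j then f (axis j 1) $ i else 0))"
  by (simp add: vec_eq_iff matrix_def sum.delta')

lemma linear_column_embedding: "linear (\<lambda>v :: real^'l. (\<chi> i k. if k = j then v $ i else 0) :: real^'k^'l)"
  by (rule linearI) (auto simp: vec_eq_iff)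

lemma has_derivative_matrix:
  fixes f :: "'z::real_normed_vector \<Rightarrow> real^'k \<Rightarrow> real^'l"
  assumes "\<And>v. ((\<lambda>x. f x v) has_derivative f' v) (at x)"
  shows "((\<lambda>x. matrix (f x)) has_derivative (\<lambda>h. matrix (\<lambda>v. f' v h))) (at x)"
  unfolding matrix_column_sum
  by (intro has_derivative_sum bounded_linear.has_derivative[OF
        linear_conv_bounded_linear[THEN iffD1, OF linear_column_embedding]] assms)

lemma Ck_on_matrix:
  fixes f :: "'z::euclidean_space \<Rightarrow> real^'k \<Rightarrow> real^'l"
  assumes "open S" "\<And>v. Ck_on k S (\<lambda>x. f x v)"
  shows "Ck_on k S (\<lambda>x. matrix (f x))"
  unfolding matrix_column_sum
  by (intro Ck_on_sum assms(1) Ck_on_linear_left[OF assms(1) linear_column_embedding] assms(2))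

definition jacobian_matrix ::
    "('a, real^'k) chart \<Rightarrow> ('b, real^'l) chart \<Rightarrow> ('a \<Rightarrow> 'b) \<Rightarrow> real^'k \<Rightarrow> real^'k^'l" where
  "jacobian_matrix c d f x = matrix (frechet_derivative (local_rep c d f) (at x))"

lemma jacobian_matrix_mult:
  assumes "smooth_map A B f" "c \<in> charts_at A p" "d \<in> charts_at B (f p)"
  shows "jacobian_matrix c d f (snd c p) *v v = jacobian c d f p v"
  using matrix_vector_mul(2)[OF linear_jacobian[OF assms]]
  by (simp add: jacobian_matrix_def jacobian_def)

lemma jacobian_matrix_differentiable:
  assumes "smooth_map A B f" "c \<in> charts_at A p" "d \<in> charts_at B (f p)"
  obtains J' where "(jacobian_matrix c d f has_derivative J') (at (snd c p))"
proof -
  have "(\<lambda>x. frechet_derivative (local_rep c d f) (at x) v) differentiable (at (snd c p))" for v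
    using smooth_on_differentiable[OF smooth_on_derivative[OF smooth_map_chart(2)[OF assms]]
        smooth_map_chart(3)[OF assms]] .
  then have "((\<lambda>x. frechet_derivative (local_rep c d f) (at x) v) has_derivative
      frechet_derivative (\<lambda>x. frechet_derivative (local_rep c d f) (at x) v) (at (snd c p)))
      (at (snd c p))" for v
    by (simp add: frechet_derivative_works)
  from has_derivative_matrix[of "\<lambda>x. frechet_derivative (local_rep c d f) (at x)", OF this]
  show thesis
    using that unfolding jacobian_matrix_def[abs_def] by blast
qed

lemma mem_tangent_chart:
  "(p, \<xi>) \<in> fst (tangent_chart E c) \<longleftrightarrow> p \<in> fst c \<and> \<xi> \<in> tangent_space E p"
  by (simp add: tangent_chart_def)

lemma tangent_chart_apply: "snd (tangent_chart E c) (p, \<xi>) = (snd c p, \<xi> c)"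
  by (simp add: tangent_chart_def)

lemma charts_at_tangent_bundle:
  "d \<in> charts_at (tangent_bundle E) (p, \<xi>) \<longleftrightarrow>
    \<xi> \<in> tangent_space E p \<and> (\<exists>c\<in>charts_at E p. d = tangent_chart E c)"
  unfolding charts_at_def tangent_bundle_def by (force simp: mem_tangent_chart simp del: split_paired_Ex)

lemma inj_tangent_chart:
  assumes "smooth_manifold E" "c \<in> E"
  shows "inj_on (snd (tangent_chart E c)) (fst (tangent_chart E c))"
proof (rule inj_onI)
  fix y z assume yz: "y \<in> fst (tangent_chart E c)" "z \<in> fst (tangent_chart E c)"
    "snd (tangent_chart E c) y = snd (tangent_chart E c) z"
  obtain p \<xi> q \<eta> where [simp]: "y = (p, \<xi>)" "z = (q, \<eta>)" by fastforce
  have p: "p \<in> fst c" "q \<in> fst c" and \<xi>: "\<xi> \<in> tangent_space E p" "\<eta> \<in> tangent_space E q"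
    and eq: "snd c p = snd c q" "\<xi> c = \<eta> c"
    using yz by (simp_all add: mem_tangent_chart tangent_chart_apply)
  have [simp]: "q = p"
    using smooth_manifold_chart(1)[OF assms] p eq(1) by (metis inj_onD)
  have "c \<in> charts_at E p" using p assms(2) by (simp add: charts_at_def)
  then have "\<xi> = \<eta>" using tvec_of_tangent \<xi> eq(2) by (metis \<open>q = p\<close>)
  then show "y = z" by simp
qed

lemma tangent_chart_image:
  fixes E :: "('a, 'v::euclidean_space) atlas"
  assumes "smooth_manifold E" "c \<in> E"
  shows "snd (tangent_chart E c) ` {y \<in> fst (tangent_chart E c). P (fst y)} =
    snd c ` {p \<in> fst c. P p} \<times> UNIV"
proof (intro set_eqI iffI)
  fix z :: "'v \<times> 'v" assume "z \<in> snd c ` {p \<in> fst c. P p} \<times> UNIV"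
  then obtain p v where p: "p \<in> fst c" "P p" "z = (snd c p, v)" by auto
  then have c: "c \<in> charts_at E p" using assms(2) by (simp add: charts_at_def)
  show "z \<in> snd (tangent_chart E c) ` {y \<in> fst (tangent_chart E c). P (fst y)}"
    using p tvec_of_in_tangent_space[OF assms(1) c, of v] tvec_of_component[OF assms(1) c, of v]
    by (intro image_eqI[of _ _ "(p, tvec_of E c p v)"])
      (simp_all add: mem_tangent_chart tangent_chart_apply)
qed (auto simp: tangent_chart_def)

lemma chart_inv_tangent_chart:
  assumes "smooth_manifold E" "c \<in> charts_at E p"
  shows "chart_inv (tangent_chart E c) (snd c p, v) = (p, tvec_of E c p v)"
proof -
  have "snd (tangent_chart E c) (p, tvec_of E c p v) = (snd c p, v)"
    by (simp add: tangent_chart_apply tvec_of_component[OF assms])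
  then show ?thesis
    using chart_inv_chart[OF inj_tangent_chart[OF assms(1)], of c "(p, tvec_of E c p v)"]
      tvec_of_in_tangent_space[OF assms] charts_atD[OF assms(2)]
    by (simp add: mem_tangent_chart)
qed

lemma eventually_nhds_fst:
  assumes "\<forall>\<^sub>F x in nhds a. P x"
  shows "\<forall>\<^sub>F z in nhds (a, b). P (fst z)"
proof -
  obtain S where "open S" "a \<in> S" "\<forall>x\<in>S. P x" using assms unfolding eventually_nhds by blast
  then show ?thesis
    unfolding eventually_nhds by (intro exI[of _ "S \<times> UNIV"]) (auto intro: open_Times)
qed

text \<open>In coordinates the lift of f is \<open>(x, v) \<mapsto> (f x, J(x) v)\<close>. Admitting any F that agrees with it on tangent
  vectors covers the identity of the tangent bundle as well, which differs from the lift of the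
  identity of E outside the tangent spaces.\<close>

lemma tangent_lift_has_derivative:
  fixes E :: "('a, real^'k) atlas" and E' :: "('b, real^'l) atlas"
  assumes E: "smooth_manifold E" and f: "smooth_map E E' f"
    and c: "c \<in> charts_at E p" and d: "d \<in> charts_at E' (f p)" and \<eta>: "\<eta> \<in> tangent_space E p"
    and F: "\<And>q \<zeta>. q \<in> fst c \<Longrightarrow> \<zeta> \<in> tangent_space E q \<Longrightarrow> F (q, \<zeta>) = tangent_lift E E' f (q, \<zeta>)"
    and J': "(jacobian_matrix c d f has_derivative J') (at (snd c p))"
  shows "(local_rep (tangent_chart E c) (tangent_chart E' d) F has_derivative
    (\<lambda>h. (jacobian c d f p (fst h),
      jacobian_matrix c d f (snd c p) *v snd h + J' (fst h) *v \<eta> c)))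
    (at (snd (tangent_chart E c) (p, \<eta>)))"
proof -
  have "((\<lambda>z. (local_rep c d f (fst z), jacobian_matrix c d f (fst z) *v snd z)) has_derivative
    (\<lambda>h. (jacobian c d f p (fst h),
      jacobian_matrix c d f (snd c p) *v snd h + J' (fst h) *v \<eta> c))) (at (snd c p, \<eta> c))"
  proof (rule has_derivative_Pair)
    have 1: "(fst has_derivative fst) (at (snd c p, \<eta> c))" and 2: "(snd has_derivative snd) (at (snd c p, \<eta> c))"
      by (auto intro: bounded_linear_imp_has_derivative bounded_linear_fst bounded_linear_snd)
    show "((\<lambda>z. local_rep c d f (fst z)) has_derivative (\<lambda>h. jacobian c d f p (fst h)))
        (at (snd c p, \<eta> c))"
      by (rule has_derivative_compose[OF 1])
        (simp add: jacobian_works[OF smooth_map_differentiable[OF f c d]])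
    have "((\<lambda>z. jacobian_matrix c d f (fst z)) has_derivative (\<lambda>h. J' (fst h))) (at (snd c p, \<eta> c))"
      by (rule has_derivative_compose[OF 1]) (simp add: J')
    from bounded_bilinear.FDERIV[OF bounded_bilinear_matrix_vector this 2]
    show "((\<lambda>z. jacobian_matrix c d f (fst z) *v snd z) has_derivative
        (\<lambda>h. jacobian_matrix c d f (snd c p) *v snd h + J' (fst h) *v \<eta> c)) (at (snd c p, \<eta> c))"
      by simp
  qed
  moreover have "\<forall>\<^sub>F z in nhds (snd c p, \<eta> c).
      (local_rep c d f (fst z), jacobian_matrix c d f (fst z) *v snd z) =
      local_rep (tangent_chart E c) (tangent_chart E' d) F z"
    using eventually_nhds_fst[OF smooth_map_eventually[OF smooth_manifold_chart(1)[OF E charts_atD(1)[OF c]] f c d]]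
  proof eventually_elim
    case (elim z)
    define q where "q = chart_inv c (fst z)"
    have q: "c \<in> charts_at E q" "d \<in> charts_at E' (f q)" and z: "z = (snd c q, snd z)"
      using elim charts_atD(1)[OF c] charts_atD(1)[OF d]
      by (auto simp: q_def charts_at_def prod_eq_iff)
    have "chart_inv (tangent_chart E c) z = (q, tvec_of E c q (snd z))"
      by (subst z) (rule chart_inv_tangent_chart[OF E q(1)])
    then have "local_rep (tangent_chart E c) (tangent_chart E' d) F z =
        (snd d (f q), tangent_map E E' f q (tvec_of E c q (snd z)) d)"
      using F[OF charts_atD(2)[OF q(1)] tvec_of_in_tangent_space[OF E q(1)]]
      by (simp add: local_rep_def tangent_lift_def tangent_chart_apply)
    also have "tangent_map E E' f q (tvec_of E c q (snd z)) d = jacobian c d f q (snd z)"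
      using tangent_map_component[OF E f tvec_of_in_tangent_space[OF E q(1)] q]
      by (simp add: tvec_of_component[OF E q(1)])
    also have "\<dots> = jacobian_matrix c d f (snd c q) *v snd z"
      by (rule jacobian_matrix_mult[OF f q, symmetric])
    also have "snd c q = fst z" using z by (metis fst_conv)
    finally show ?case by (simp add: local_rep_def q_def)
  qed
  ultimately show ?thesis
    unfolding tangent_chart_apply by (rule has_derivative_eventually_eq)
qed

lemma tangent_lift_ident:
  assumes "smooth_manifold E" "c \<in> E" "q \<in> fst c" "\<zeta> \<in> tangent_space E q"
  shows "(q, \<zeta>) = tangent_lift E E (\<lambda>q. q) (q, \<zeta>)"
  using tangent_map_ident[OF assms(1,4), of c] assms(2,3) by (simp add: tangent_lift_def charts_at_def)

lemma connection_lift: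
  assumes "connection N F \<rho> h" "y \<in> points F" "\<xi> \<in> tangent_space N (\<rho> y)"
  shows "h y \<xi> \<in> tangent_space F y" "tangent_map F N \<rho> y (h y \<xi>) = \<xi>"
  using assms unfolding connection_def by blast+

lemma connection_linear:
  assumes "connection N F \<rho> h" "y \<in> points F" "\<xi> \<in> tangent_space N (\<rho> y)" "\<eta> \<in> tangent_space N (\<rho> y)"
  shows "h y (\<lambda>c. a *\<^sub>R \<xi> c + b *\<^sub>R \<eta> c) d = a *\<^sub>R h y \<xi> d + b *\<^sub>R h y \<eta> d"
proof -
  have "\<forall>y\<in>points F. \<forall>\<xi>\<in>tangent_space N (\<rho> y). \<forall>\<eta>\<in>tangent_space N (\<rho> y). \<forall>a b :: real.
      h y (\<lambda>c. a *\<^sub>R \<xi> c + b *\<^sub>R \<eta> c) = (\<lambda>d. a *\<^sub>R h y \<xi> d + b *\<^sub>R h y \<eta> d)"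
    using assms(1) unfolding connection_def by (elim conjE)
  from fun_cong[OF this[rule_format, OF assms(2-4)]] show ?thesis .
qed

lemma points_charts_at: "c \<in> charts_at A p \<Longrightarrow> p \<in> points A"
  by (auto simp: charts_at_def points_def)

text \<open>The projection condition on a connection refers to one chosen chart of the tangent bundle; in this
  chart the claim is immediate, and the transition maps carry it to the others.\<close>

lemma tangent_lifting_base_component:
  fixes E :: "('a, real^'k) atlas"
  assumes E: "smooth_manifold E" and \<Gamma>: "connection E (tangent_bundle E) fst \<Gamma>"
    and c: "c \<in> charts_at E p" and \<xi>: "\<xi> \<in> tangent_space E p" and \<eta>: "\<eta> \<in> tangent_space E p"
  shows "fst (\<Gamma> (p, \<eta>) \<xi> (tangent_chart E c)) = \<xi> c"
proof -
  note ident = smooth_map_ident[OF E]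
  let ?d = "SOME d. d \<in> charts_at (tangent_bundle E) (p, \<eta>)"
  have tc: "tangent_chart E c \<in> charts_at (tangent_bundle E) (p, \<eta>)"
    using c \<eta> by (auto simp: charts_at_tangent_bundle)
  have lift: "\<Gamma> (p, \<eta>) \<xi> \<in> tangent_space (tangent_bundle E) (p, \<eta>)"
      "tangent_map (tangent_bundle E) E fst (p, \<eta>) (\<Gamma> (p, \<eta>) \<xi>) = \<xi>"
    using connection_lift[OF \<Gamma> points_charts_at[OF tc]] \<xi> by simp_all
  have d: "?d \<in> charts_at (tangent_bundle E) (p, \<eta>)" using tc by (rule someI)
  then obtain c0 where c0: "c0 \<in> charts_at E p" "?d = tangent_chart E c0"
    by (auto simp: charts_at_tangent_bundle)
  have "(local_rep (tangent_chart E c0) c0 fst has_derivative fst) (at (snd (tangent_chart E c0) (p, \<eta>)))"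
    unfolding tangent_chart_apply
  proof (rule has_derivative_eventually_eq)
    show "(fst has_derivative fst) (at (snd c0 p, \<eta> c0))"
      by (rule bounded_linear_imp_has_derivative[OF bounded_linear_fst])
    show "\<forall>\<^sub>F z in nhds (snd c0 p, \<eta> c0). fst z = local_rep (tangent_chart E c0) c0 fst z"
      using eventually_nhds_fst[OF smooth_map_eventually[OF
            smooth_manifold_chart(1)[OF E charts_atD(1)[OF c0(1)]] ident c0(1) c0(1)]]
    proof eventually_elim
      case (elim z)
      have "c0 \<in> charts_at E (chart_inv c0 (fst z))"
        using elim charts_atD(1)[OF c0(1)] by (simp add: charts_at_def)
      from chart_inv_tangent_chart[OF E this, of "snd z"] show ?case
        using elim by (simp add: local_rep_def)
    qed
  qed
  then have "jacobian (tangent_chart E c0) c0 fst (p, \<eta>) = fst" by (rule jacobianI)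
  moreover have "\<xi> c0 = jacobian (tangent_chart E c0) c0 fst (p, \<eta>) (\<Gamma> (p, \<eta>) \<xi> (tangent_chart E c0))"
    by (subst (1) lift(2)[symmetric]) (simp add: tangent_map_def c0 Let_def)
  ultimately have base: "fst (\<Gamma> (p, \<eta>) \<xi> (tangent_chart E c0)) = \<xi> c0" by simp
  obtain J' where "(jacobian_matrix c0 c (\<lambda>q. q) has_derivative J') (at (snd c0 p))"
    using jacobian_matrix_differentiable[OF ident c0(1) c] by blast
  from tangent_lift_has_derivative[OF E ident c0(1) c \<eta> tangent_lift_ident[OF E charts_atD(1)[OF c0(1)]] this]
  have "jacobian (tangent_chart E c0) (tangent_chart E c) (\<lambda>y. y) (p, \<eta>) =
      (\<lambda>h. (jacobian c0 c (\<lambda>q. q) p (fst h),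
        jacobian_matrix c0 c (\<lambda>q. q) (snd c0 p) *v snd h + J' (fst h) *v \<eta> c0))"
    by (rule jacobianI)
  moreover have "\<Gamma> (p, \<eta>) \<xi> (tangent_chart E c) =
      jacobian (tangent_chart E c0) (tangent_chart E c) (\<lambda>y. y) (p, \<eta>)
        (\<Gamma> (p, \<eta>) \<xi> (tangent_chart E c0))"
    using tangent_space_transform[OF lift(1) _ tc] d c0(2) by metis
  ultimately show ?thesis
    using base tangent_space_transform[OF \<xi> c0(1) c] by simp
qed

definition connection_matrix ::
    "('a, real^'k) atlas \<Rightarrow> ('a, real^'k) tangent_lifting \<Rightarrow> ('a, real^'k) chart \<Rightarrow> 'a \<Rightarrow>
     ('a, real^'k) tvec \<Rightarrow> real^'k^'k" where
  "connection_matrix E \<Gamma> c p \<xi> = matrix (\<lambda>v. lift_coeff E \<Gamma> c p \<xi> (tvec_of E c p v))"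

lemma connection_matrix_mult:
  assumes E: "smooth_manifold E" and \<Gamma>: "linear_connection E \<Gamma>"
    and c: "c \<in> charts_at E p" and \<xi>: "\<xi> \<in> tangent_space E p" and \<eta>: "\<eta> \<in> tangent_space E p"
  shows "connection_matrix E \<Gamma> c p \<xi> *v \<eta> c = lift_coeff E \<Gamma> c p \<xi> \<eta>"
proof -
  have *: "lift_coeff E \<Gamma> c p \<xi> (tvec_of E c p (a *\<^sub>R v + b *\<^sub>R w)) =
      a *\<^sub>R lift_coeff E \<Gamma> c p \<xi> (tvec_of E c p v) + b *\<^sub>R lift_coeff E \<Gamma> c p \<xi> (tvec_of E c p w)" for a b v w
  proof -
    have "\<forall>c\<in>E. \<forall>p\<in>fst c. \<forall>\<xi>\<in>tangent_space E p. \<forall>\<eta>\<in>tangent_space E p. \<forall>\<zeta>\<in>tangent_space E p.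
        \<forall>a b :: real. lift_coeff E \<Gamma> c p \<xi> (\<lambda>c. a *\<^sub>R \<eta> c + b *\<^sub>R \<zeta> c) =
          a *\<^sub>R lift_coeff E \<Gamma> c p \<xi> \<eta> + b *\<^sub>R lift_coeff E \<Gamma> c p \<xi> \<zeta>"
      using \<Gamma> unfolding linear_connection_def by (elim conjE)
    from this[rule_format, OF charts_atD[OF c] \<xi> tvec_of_in_tangent_space[OF E c]
        tvec_of_in_tangent_space[OF E c], of a v b w]
    show ?thesis by (simp add: tvec_of_linear[OF E c])
  qed
  have "linear (\<lambda>v. lift_coeff E \<Gamma> c p \<xi> (tvec_of E c p v))"
  proof (rule linearI)
    show "lift_coeff E \<Gamma> c p \<xi> (tvec_of E c p (v + w)) =
        lift_coeff E \<Gamma> c p \<xi> (tvec_of E c p v) + lift_coeff E \<Gamma> c p \<xi> (tvec_of E c p w)" for v w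
      using *[of 1 v 1 w] by simp
    show "lift_coeff E \<Gamma> c p \<xi> (tvec_of E c p (r *\<^sub>R v)) = r *\<^sub>R lift_coeff E \<Gamma> c p \<xi> (tvec_of E c p v)" for r v
      using *[of r v 0 0] by simp
  qed
  from fun_cong[OF matrix_vector_mul(2)[OF this], of "\<eta> c"] show ?thesis
    by (simp add: connection_matrix_def tvec_of_tangent[OF \<eta> c])
qed

text \<open>The inhomogeneous transformation law of connection coefficients. It results from comparing fibre
  components of the two sides of the relation between the connections, applied to
  the horizontal lift at the tangent vector with components v.\<close>

lemma connection_matrix_transform:
  fixes E :: "('a, real^'k) atlas" and E' :: "('b, real^'l) atlas"
  assumes E: "smooth_manifold E" and \<Gamma>: "linear_connection E \<Gamma>"
    and E': "smooth_manifold E'" and \<Gamma>': "linear_connection E' \<Gamma>'"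
    and f: "smooth_map E E' f"
    and rel: "related_connections E (tangent_bundle E) fst E' (tangent_bundle E') f
      (tangent_lift E E' f) \<Gamma> \<Gamma>'"
    and c: "c \<in> charts_at E p" and d: "d \<in> charts_at E' (f p)" and \<xi>: "\<xi> \<in> tangent_space E p"
    and J': "(jacobian_matrix c d f has_derivative J') (at (snd c p))"
  shows "connection_matrix E' \<Gamma>' d (f p) (tangent_map E E' f p \<xi>) ** jacobian_matrix c d f (snd c p) =
    J' (\<xi> c) + jacobian_matrix c d f (snd c p) ** connection_matrix E \<Gamma> c p \<xi>"
  unfolding matrix_eq
proof
  fix v
  note ident = smooth_map_ident[OF E]
  let ?T = "tangent_bundle E" and ?T' = "tangent_bundle E'" and ?F = "tangent_lift E E' f"
  let ?\<eta> = "tvec_of E c p v" and ?J = "jacobian_matrix c d f (snd c p)"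
  let ?y = "(p, ?\<eta>)" and ?\<xi>' = "tangent_map E E' f p \<xi>" and ?\<eta>' = "tangent_map E E' f p (tvec_of E c p v)"
  let ?c = "tangent_chart E c" and ?d = "tangent_chart E' d"
  have \<Gamma>c: "connection E ?T fst \<Gamma>" using \<Gamma> by (simp add: linear_connection_def)
  have \<eta>: "?\<eta> \<in> tangent_space E p" by (rule tvec_of_in_tangent_space[OF E c])
  have \<eta>': "?\<eta>' \<in> tangent_space E' (f p)" and \<xi>': "?\<xi>' \<in> tangent_space E' (f p)"
    by (rule tangent_map_in_tangent_space[OF E E' f _ c]; fact)+
  have tc: "?c \<in> charts_at ?T ?y" using c \<eta> by (auto simp: charts_at_tangent_bundle)
  have td: "?d \<in> charts_at ?T' (?F ?y)"
    using d \<eta>' by (auto simp: charts_at_tangent_bundle tangent_lift_def)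
  have lift: "\<Gamma> ?y \<xi> \<in> tangent_space ?T ?y"
    using connection_lift(1)[OF \<Gamma>c points_charts_at[OF tc]] \<xi> by simp
  let ?e = "SOME e. e \<in> charts_at ?T ?y"
  have e: "?e \<in> charts_at ?T ?y" using tc by (rule someI)
  then obtain c0 where c0: "c0 \<in> charts_at E p" "?e = tangent_chart E c0"
    by (auto simp: charts_at_tangent_bundle)
  \<comment> \<open>The tangent map is evaluated in some chart induced by c0, not necessarily in the one induced by c; the
    chain rule on the tangent bundle compensates for this.\<close>
  have "tangent_map ?T ?T' ?F ?y (\<Gamma> ?y \<xi>) ?d = jacobian ?c ?d ?F ?y (\<Gamma> ?y \<xi> ?c)"
  proof -
    obtain K' where K': "(jacobian_matrix c c0 (\<lambda>q. q) has_derivative K') (at (snd c p))"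
      using jacobian_matrix_differentiable[OF ident c c0(1)] by blast
    obtain L' where L': "(jacobian_matrix c0 d f has_derivative L') (at (snd c0 p))"
      using jacobian_matrix_differentiable[OF f c0(1) d] by blast
    have "jacobian ?c ?d (\<lambda>y. ?F y) ?y (\<Gamma> ?y \<xi> ?c) =
        jacobian (tangent_chart E c0) ?d ?F ?y
          (jacobian ?c (tangent_chart E c0) (\<lambda>y. y) ?y (\<Gamma> ?y \<xi> ?c))"
    proof (rule jacobian_compose)
      show "inj_on (snd ?c) (fst ?c)" "?y \<in> fst ?c"
          "inj_on (snd (tangent_chart E c0)) (fst (tangent_chart E c0))"
        using inj_tangent_chart[OF E] charts_atD[OF c] charts_atD[OF c0(1)] \<eta>
        by (auto simp: mem_tangent_chart)
      show "local_rep (tangent_chart E c0) ?d ?F differentiable at (snd (tangent_chart E c0) ?y)"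
        using tangent_lift_has_derivative[OF E f c0(1) d \<eta> refl L'] by (rule differentiableI)
      show "local_rep ?c (tangent_chart E c0) (\<lambda>y. y) differentiable at (snd ?c ?y)"
        using tangent_lift_has_derivative[OF E ident c c0(1) \<eta> tangent_lift_ident[OF E charts_atD(1)[OF c]] K']
        by (rule differentiableI)
      have "\<forall>\<^sub>F z in nhds (snd c p, v). chart_inv ?c z \<in> fst (tangent_chart E c0)"
        using eventually_nhds_fst[OF smooth_map_eventually[OF
              smooth_manifold_chart(1)[OF E charts_atD(1)[OF c]] ident c c0(1)]]
      proof eventually_elim
        case (elim z)
        have q: "c \<in> charts_at E (chart_inv c (fst z))"
          using elim charts_atD(1)[OF c] by (simp add: charts_at_def)
        show ?case
          using chart_inv_tangent_chart[OF E q, of "snd z"] tvec_of_in_tangent_space[OF E q] elim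
          by (simp add: mem_tangent_chart)
      qed
      then show "\<forall>\<^sub>F z in nhds (snd ?c ?y). chart_inv ?c z \<in> fst (tangent_chart E c0)"
        by (simp add: tangent_chart_apply tvec_of_component[OF E c])
    qed
    moreover have "jacobian ?c (tangent_chart E c0) (\<lambda>y. y) ?y (\<Gamma> ?y \<xi> ?c) = \<Gamma> ?y \<xi> (tangent_chart E c0)"
      using tangent_space_transform[OF lift tc] e c0(2) by metis
    ultimately show ?thesis using td by (simp add: tangent_map_def c0(2) Let_def)
  qed
  also have "snd \<dots> = ?J *v lift_coeff E \<Gamma> c p \<xi> ?\<eta> + J' (\<xi> c) *v v"
    using jacobianI[OF tangent_lift_has_derivative[OF E f c d \<eta> refl J']]
      tangent_lifting_base_component[OF E \<Gamma>c c \<xi> \<eta>]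
    by (simp add: lift_coeff_def tvec_of_component[OF E c])
  also have "tangent_map ?T ?T' ?F ?y (\<Gamma> ?y \<xi>) = \<Gamma>' (?F ?y) ?\<xi>'"
  proof -
    have "\<xi> \<in> tangent_space E (fst ?y)" using \<xi> by simp
    then have "tangent_map ?T ?T' ?F ?y (\<Gamma> ?y \<xi>) = \<Gamma>' (?F ?y) (tangent_map E E' f (fst ?y) \<xi>)"
      using rel points_charts_at[OF tc] unfolding related_connections_def by blast
    then show ?thesis by simp
  qed
  also have "snd (\<Gamma>' (?F ?y) ?\<xi>' ?d) = connection_matrix E' \<Gamma>' d (f p) ?\<xi>' *v ?\<eta>' d"
    unfolding connection_matrix_mult[OF E' \<Gamma>' d \<xi>' \<eta>'] by (simp add: lift_coeff_def tangent_lift_def)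
  also have "?\<eta>' d = ?J *v v"
    unfolding tangent_map_component[OF E f \<eta> c d] jacobian_matrix_mult[OF f c d]
    by (simp add: tvec_of_component[OF E c])
  also have "lift_coeff E \<Gamma> c p \<xi> ?\<eta> = connection_matrix E \<Gamma> c p \<xi> *v v"
    using connection_matrix_mult[OF E \<Gamma> c \<xi> \<eta>] by (simp add: tvec_of_component[OF E c])
  finally show "(connection_matrix E' \<Gamma>' d (f p) ?\<xi>' ** ?J) *v v =
      (J' (\<xi> c) + ?J ** connection_matrix E \<Gamma> c p \<xi>) *v v"
    by (simp add: matrix_vector_mul_assoc matrix_vector_mult_add_rdistrib)
qed

text \<open>This makes the transformation law available for changes of charts.\<close>

lemma related_connections_ident:
  fixes E :: "('a, real^'k) atlas"
  assumes E: "smooth_manifold E" and \<Gamma>: "connection E (tangent_bundle E) fst \<Gamma>"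
  shows "related_connections E (tangent_bundle E) fst E (tangent_bundle E) (\<lambda>q. q)
    (tangent_lift E E (\<lambda>q. q)) \<Gamma> \<Gamma>"
  unfolding related_connections_def
proof (intro ballI ext)
  note ident = smooth_map_ident[OF E]
  let ?T = "tangent_bundle E"
  let ?F = "tangent_lift E E (\<lambda>q. q)"
  fix y \<xi> d assume y: "y \<in> points ?T" and \<xi>: "\<xi> \<in> tangent_space E (fst y)"
  obtain p \<eta> where [simp]: "y = (p, \<eta>)" by fastforce
  obtain c where c: "c \<in> charts_at E p" and \<eta>: "\<eta> \<in> tangent_space E p"
    using y by (auto simp: points_def tangent_bundle_def mem_tangent_chart charts_at_def)
  have F: "?F y = y" "tangent_map E E (\<lambda>q. q) (fst y) \<xi> = \<xi>"
    using tangent_lift_ident[OF E charts_atD[OF c] \<eta>] tangent_map_ident[OF E \<xi>, of c] c by simp_all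
  have lift: "\<Gamma> y \<xi> \<in> tangent_space ?T y" by (rule connection_lift(1)[OF \<Gamma> y \<xi>])
  have "tangent_map ?T ?T ?F y (\<Gamma> y \<xi>) d = \<Gamma> y \<xi> d"
  proof (cases "d \<in> charts_at ?T y")
    case True
    let ?e = "SOME e. e \<in> charts_at ?T y"
    have e: "?e \<in> charts_at ?T y" using True by (rule someI)
    obtain c0 c1 where c0: "c0 \<in> charts_at E p" "?e = tangent_chart E c0"
        and c1: "c1 \<in> charts_at E p" "d = tangent_chart E c1"
      using e True by (auto simp: charts_at_tangent_bundle)
    obtain J' where J': "(jacobian_matrix c0 c1 (\<lambda>q. q) has_derivative J') (at (snd c0 p))"
      using jacobian_matrix_differentiable[OF ident c0(1) c1(1)] by blast
    note id_der = tangent_lift_has_derivative[OF E ident c0(1) c1(1) \<eta>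
        tangent_lift_ident[OF E charts_atD(1)[OF c0(1)]] J']
    have "jacobian ?e d ?F y = jacobian ?e d (\<lambda>y. y) y"
      unfolding c0(2) c1(2)
      using jacobianI[OF id_der] jacobianI[OF tangent_lift_has_derivative[OF E ident c0(1) c1(1) \<eta> refl J']]
      by simp
    then show ?thesis
      using tangent_space_transform[OF lift e True] True F(1) by (simp add: tangent_map_def Let_def)
  next
    case False
    then show ?thesis using tangent_space_outside[OF lift False] F(1) by (simp add: tangent_map_def)
  qed
  then show "tangent_map ?T ?T ?F y (\<Gamma> y \<xi>) d = \<Gamma> (?F y) (tangent_map E E (\<lambda>q. q) (fst y) \<xi>) d"
    by (simp only: F)
qed

section \<open>The induced connection on the bundle of planes\<close>

definition plane_of ::
    "('a, real^('n::finite + 'm::finite)) atlas \<Rightarrow> ('a, real^('n + 'm)) chart \<Rightarrow>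
     real^('n + 'm)^('n + 'm) \<Rightarrow> 'a \<Rightarrow> real^'n^'m \<Rightarrow> ('a, real^('n + 'm)) tvec set" where
  "plane_of E c G p Y = {\<xi> \<in> tangent_space E p. G *v \<xi> c \<in> graph_plane Y}"

lemma plane_of_components:
  assumes E: "smooth_manifold E" and c: "c \<in> charts_at E p" and G: "invertible G"
  shows "(\<lambda>\<xi>. \<xi> c) ` plane_of E c G p Y = (*v) (matrix_inv G) ` graph_plane Y"
    and "(\<lambda>\<xi>. G *v \<xi> c) ` plane_of E c G p Y = graph_plane Y"
proof -
  have G_inv: "G *v (matrix_inv G *v z) = z" "matrix_inv G *v (G *v z) = z" for z
    by (simp_all add: matrix_vector_mul_assoc matrix_inv_right[OF G] matrix_inv_left[OF G])
  show 1: "(\<lambda>\<xi>. \<xi> c) ` plane_of E c G p Y = (*v) (matrix_inv G) ` graph_plane Y"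
  proof (intro set_eqI iffI)
    fix v assume "v \<in> (\<lambda>\<xi>. \<xi> c) ` plane_of E c G p Y"
    then show "v \<in> (*v) (matrix_inv G) ` graph_plane Y"
      by (auto simp: plane_of_def intro!: image_eqI[of _ _ "G *v v"] simp: G_inv)
  next
    fix v assume "v \<in> (*v) (matrix_inv G) ` graph_plane Y"
    then obtain z where "v = matrix_inv G *v z" "z \<in> graph_plane Y" by blast
    then show "v \<in> (\<lambda>\<xi>. \<xi> c) ` plane_of E c G p Y"
      by (intro image_eqI[of _ _ "tvec_of E c p v"])
        (simp_all add: plane_of_def tvec_of_in_tangent_space[OF E c] tvec_of_component[OF E c] G_inv)
  qed
  have "(\<lambda>\<xi>. G *v \<xi> c) ` plane_of E c G p Y = (*v) G ` (\<lambda>\<xi>. \<xi> c) ` plane_of E c G p Y"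
    by (simp add: image_image)
  then show "(\<lambda>\<xi>. G *v \<xi> c) ` plane_of E c G p Y = graph_plane Y"
    unfolding 1 by (simp add: image_image G_inv)
qed

lemma inj_jacobian_transition:
  assumes E: "smooth_manifold E" and c: "c \<in> charts_at E p" and d: "d \<in> charts_at E p"
  shows "inj (jacobian c d (\<lambda>q. q) p)"
proof (rule inj_on_inverseI)
  note ident = smooth_map_ident[OF E]
  show "jacobian d c (\<lambda>q. q) p (jacobian c d (\<lambda>q. q) p v) = v" for v
    using smooth_map_chain[OF E E ident ident c d c, of v]
      jacobian_ident[OF smooth_manifold_chart[OF E charts_atD(1)[OF c]] charts_atD(2)[OF c], of v]
    by (rule trans[OF sym])
qed

text \<open>The components in any other chart are an injective linear image of the graph.\<close>

lemma plane_of_in_tangent_planes: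
  fixes E :: "('a, real^('n::finite + 'm::finite)) atlas"
  assumes E: "smooth_manifold E" and c: "c \<in> charts_at E p" and G: "invertible G"
  shows "plane_of E c G p Y \<in> tangent_planes E p"
proof -
  have "subspace ((\<lambda>\<xi>. \<xi> d) ` plane_of E c G p Y) \<and> dim ((\<lambda>\<xi>. \<xi> d) ` plane_of E c G p Y) = CARD('n)"
    if d: "d \<in> charts_at E p" for d
  proof -
    let ?J = "jacobian c d (\<lambda>q. q) p"
    let ?L = "\<lambda>z. ?J (matrix_inv G *v z)"
    have "(\<lambda>\<xi>. \<xi> d) ` plane_of E c G p Y = ?J ` (\<lambda>\<xi>. \<xi> c) ` plane_of E c G p Y"
      unfolding image_image
      using tangent_space_transform[OF _ c d] by (intro image_cong) (auto simp: plane_of_def)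
    also have "\<dots> = ?L ` graph_plane Y"
      unfolding plane_of_components(1)[OF E c G] image_image ..
    finally have eq: "(\<lambda>\<xi>. \<xi> d) ` plane_of E c G p Y = ?L ` graph_plane Y" .
    have L: "linear ?L"
      using linear_compose[OF matrix_vector_mul_linear linear_jacobian[OF smooth_map_ident[OF E] c d]]
      by (simp add: o_def)
    have "inj ((*v) (matrix_inv G))"
      by (metis matrix_inv_right[OF G] matrix_left_invertible_injective)
    then have "inj ?L"
      using inj_compose[OF inj_jacobian_transition[OF E c d]] by (simp add: o_def)
    then have "dim (?L ` graph_plane Y) = dim (graph_plane Y)"
      by (intro dim_image_eq[OF L]) (rule inj_on_subset, auto)
    then show ?thesis
      unfolding eq by (simp add: dim_graph_plane linear_subspace_image[OF L graph_plane_subspace])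
  qed
  then show ?thesis by (auto simp: tangent_planes_def plane_of_def)
qed

lemma plane_eq_plane_of:
  assumes E: "smooth_manifold E" and c: "c \<in> charts_at E p" and G: "invertible G"
    and W: "W \<subseteq> tangent_space E p" and eq: "(\<lambda>\<xi>. G *v \<xi> c) ` W = graph_plane Y"
  shows "W = plane_of E c G p Y"
proof
  show "W \<subseteq> plane_of E c G p Y" using W eq by (auto simp: plane_of_def)
  show "plane_of E c G p Y \<subseteq> W"
  proof
    fix \<xi> assume \<xi>: "\<xi> \<in> plane_of E c G p Y"
    then obtain \<eta> where \<eta>: "\<eta> \<in> W" "G *v \<xi> c = G *v \<eta> c" unfolding plane_of_def eq[symmetric] by blast
    then have "\<xi> c = \<eta> c"
      by (metis matrix_inv_left[OF G] matrix_vector_mul_assoc matrix_vector_mul_lid)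
    then have "\<xi> = \<eta>"
      using tvec_of_tangent[OF _ c] \<xi> \<eta>(1) W by (metis (no_types, lifting) mem_Collect_eq plane_of_def subsetD)
    then show "\<xi> \<in> W" using \<eta>(1) by simp
  qed
qed

lemma plane_of_in_chart:
  assumes "smooth_manifold E" "c \<in> charts_at E p" "invertible G"
  shows "(p, plane_of E c G p Y) \<in> fst (plane_chart E c G)"
    and "snd (plane_chart E c G) (p, plane_of E c G p Y) = (snd c p, Y)"
  using plane_of_in_tangent_planes[OF assms] plane_of_components(2)[OF assms] charts_atD(2)[OF assms(2)]
  by (auto simp: plane_chart_def the_graph_plane)

lemma plane_chart_domainE:
  assumes "smooth_manifold E" "c \<in> E" "invertible G" "(p, W) \<in> fst (plane_chart E c G)"
  obtains Y where "c \<in> charts_at E p" "W = plane_of E c G p Y"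
proof -
  obtain Y where p: "p \<in> fst c" and W: "W \<in> tangent_planes E p"
      and Y: "(\<lambda>\<xi>. G *v \<xi> c) ` W = graph_plane Y"
    using assms(4) by (auto simp: plane_chart_def)
  have c: "c \<in> charts_at E p" using p assms(2) by (simp add: charts_at_def)
  show thesis
    using plane_eq_plane_of[OF assms(1) c assms(3) _ Y] W c that by (auto simp: tangent_planes_def)
qed

lemma inj_plane_chart:
  assumes "smooth_manifold E" "c \<in> E" "invertible G"
  shows "inj_on (snd (plane_chart E c G)) (fst (plane_chart E c G))"
proof (rule inj_onI)
  fix y z assume y: "y \<in> fst (plane_chart E c G)" and z: "z \<in> fst (plane_chart E c G)"
    and eq: "snd (plane_chart E c G) y = snd (plane_chart E c G) z"
  obtain p W q V where [simp]: "y = (p, W)" "z = (q, V)" by fastforce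
  obtain Y where p: "c \<in> charts_at E p" "W = plane_of E c G p Y"
    using plane_chart_domainE[OF assms, of p W] y by auto
  obtain Z where q: "c \<in> charts_at E q" "V = plane_of E c G q Z"
    using plane_chart_domainE[OF assms, of q V] z by auto
  have "snd c p = snd c q" "Y = Z"
    using eq plane_of_in_chart(2)[OF assms(1) p(1) assms(3)] plane_of_in_chart(2)[OF assms(1) q(1) assms(3)]
    by (simp_all add: p(2) q(2))
  moreover from this have "p = q"
    using smooth_manifold_chart(1)[OF assms(1,2)] charts_atD(2)[OF p(1)] charts_atD(2)[OF q(1)]
    by (metis inj_onD)
  ultimately show "y = z" using p(2) q(2) by simp
qed

lemma chart_inv_plane_chart:
  assumes "smooth_manifold E" "c \<in> charts_at E p" "invertible G"
  shows "chart_inv (plane_chart E c G) (snd c p, Y) = (p, plane_of E c G p Y)"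
  using chart_inv_chart[OF inj_plane_chart[OF assms(1) charts_atD(1)[OF assms(2)] assms(3)]
      plane_of_in_chart(1)[OF assms]]
  by (simp add: plane_of_in_chart(2)[OF assms])

lemma plane_chart_image:
  fixes E :: "('a, real^('n::finite + 'm::finite)) atlas"
  assumes "smooth_manifold E" "c \<in> E" "invertible G"
  shows "snd (plane_chart E c G) ` {y \<in> fst (plane_chart E c G). P (fst y)} =
    snd c ` {p \<in> fst c. P p} \<times> UNIV"
proof (intro set_eqI iffI)
  fix z :: "(real^('n + 'm)) \<times> (real^'n^'m)" assume "z \<in> snd c ` {p \<in> fst c. P p} \<times> UNIV"
  then obtain p Y where p: "p \<in> fst c" "P p" "z = (snd c p, Y)" by auto
  then have c: "c \<in> charts_at E p" using assms(2) by (simp add: charts_at_def)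
  show "z \<in> snd (plane_chart E c G) ` {y \<in> fst (plane_chart E c G). P (fst y)}"
    using p plane_of_in_chart[OF assms(1) c assms(3), of Y]
    by (intro image_eqI[of _ _ "(p, plane_of E c G p Y)"]) simp_all
qed (auto simp: plane_chart_def)

text \<open>In blocks with respect to the first n and the last m coordinates, with B the connection matrix in
  the basis given by G, this is B21 + B22 Y - Y B11 - Y B12 Y.\<close>

definition plane_velocity ::
    "('a, real^('n::finite + 'm::finite)) atlas \<Rightarrow> ('a, real^('n + 'm)) tangent_lifting \<Rightarrow>
     ('a, real^('n + 'm)) chart \<Rightarrow> real^('n + 'm)^('n + 'm) \<Rightarrow> 'a \<Rightarrow> ('a, real^('n + 'm)) tvec \<Rightarrow>
     real^'n^'m \<Rightarrow> real^'n^'m" where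
  "plane_velocity E \<Gamma> c G p \<xi> Y =
     graph_conormal Y ** (G ** connection_matrix E \<Gamma> c p \<xi> ** matrix_inv G) ** graph_frame Y"

definition plane_lift ::
    "('a, real^('n::finite + 'm::finite)) atlas \<Rightarrow> ('a, real^('n + 'm)) tangent_lifting \<Rightarrow>
     ('a, real^('n + 'm)) chart \<Rightarrow> real^('n + 'm)^('n + 'm) \<Rightarrow>
     'a \<times> ('a, real^('n + 'm)) tvec set \<Rightarrow> ('a, real^('n + 'm)) tvec \<Rightarrow>
     (real^('n + 'm)) \<times> (real^'n^'m)" where
  "plane_lift E \<Gamma> c G y \<xi> =
     (\<xi> c, plane_velocity E \<Gamma> c G (fst y) \<xi> (snd (snd (plane_chart E c G) y)))"

lemma image_tangent_map_plane:
  assumes E: "smooth_manifold E" and f: "smooth_map E E' f"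
    and c: "c \<in> charts_at E q" and d: "d \<in> charts_at E' (f q)" and G: "invertible G"
  shows "(\<lambda>\<xi>. G' *v \<xi> d) ` tangent_map E E' f q ` plane_of E c G q Y =
    (*v) (G' ** jacobian_matrix c d f (snd c q) ** matrix_inv G) ` graph_plane Y"
proof -
  have "(\<lambda>\<xi>. G' *v \<xi> d) ` tangent_map E E' f q ` plane_of E c G q Y =
      (\<lambda>v. G' *v (jacobian_matrix c d f (snd c q) *v v)) ` (\<lambda>\<xi>. \<xi> c) ` plane_of E c G q Y"
    unfolding image_image
    by (intro image_cong refl)
      (simp add: plane_of_def tangent_map_component[OF E f _ c d] jacobian_matrix_mult[OF f c d])
  then show ?thesis
    unfolding plane_of_components(1)[OF E c G] image_image
    by (simp add: matrix_vector_mul_assoc matrix_mul_assoc)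
qed

text \<open>In coordinates the induced map on planes is \<open>(x, Y) \<mapsto> (f x, slope_map M(x) Y)\<close>. As for tangent
  bundles, F stands for the lift of f or for the identity of the bundle of planes.\<close>

lemma J1_lift_has_derivative:
  fixes E :: "('a, real^('n::finite + 'm::finite)) atlas" and E' :: "('b, real^('n + 'm)) atlas"
  assumes E: "smooth_manifold E" and f: "smooth_map E E' f"
    and c: "c \<in> charts_at E p" and d: "d \<in> charts_at E' (f p)"
    and G: "invertible G" and G': "invertible G'"
    and F: "\<And>q V. V \<subseteq> tangent_space E q \<Longrightarrow> q \<in> fst c \<Longrightarrow> F (q, V) = J1_lift E E' f (q, V)"
    and W: "W = plane_of E c G p Y"
    and inv: "invertible (base_proj ** (G' ** jacobian_matrix c d f (snd c p) ** matrix_inv G) ** graph_frame Y)"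
    and J': "(jacobian_matrix c d f has_derivative J') (at (snd c p))"
  defines "M \<equiv> G' ** jacobian_matrix c d f (snd c p) ** matrix_inv G"
  shows "(local_rep (plane_chart E c G) (plane_chart E' d G') F has_derivative
    (\<lambda>h. (jacobian c d f p (fst h),
      graph_conormal (slope_map M Y) **
        (G' ** J' (fst h) ** matrix_inv G ** graph_frame Y + M ** (fibre_incl ** snd h)) **
        matrix_inv (base_proj ** M ** graph_frame Y))))
    (at (snd (plane_chart E c G) (p, W)))"
proof -
  let ?M = "\<lambda>x. G' ** jacobian_matrix c d f x ** matrix_inv G"
  have 1: "(fst has_derivative fst) (at (snd c p, Y))" and 2: "(snd has_derivative snd) (at (snd c p, Y))"
    by (auto intro: bounded_linear_imp_has_derivative bounded_linear_fst bounded_linear_snd)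
  note mm = bounded_bilinear_matrix_mult
  have J: "((\<lambda>z. jacobian_matrix c d f (fst z)) has_derivative (\<lambda>h. J' (fst h))) (at (snd c p, Y))"
    by (rule has_derivative_compose[OF 1]) (simp add: J')
  have M': "((\<lambda>z. ?M (fst z)) has_derivative (\<lambda>h. G' ** J' (fst h) ** matrix_inv G)) (at (snd c p, Y))"
    by (rule bounded_linear.has_derivative[OF bounded_bilinear.bounded_linear_left[OF mm]
          bounded_linear.has_derivative[OF bounded_bilinear.bounded_linear_right[OF mm] J]])
  have "((\<lambda>z. (local_rep c d f (fst z), slope_map (?M (fst z)) (snd z))) has_derivative
    (\<lambda>h. (jacobian c d f p (fst h),
      graph_conormal (slope_map M Y) **
        (G' ** J' (fst h) ** matrix_inv G ** graph_frame Y + M ** (fibre_incl ** snd h)) **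
        matrix_inv (base_proj ** M ** graph_frame Y)))) (at (snd c p, Y))"
  proof (rule has_derivative_Pair)
    show "((\<lambda>z. local_rep c d f (fst z)) has_derivative (\<lambda>h. jacobian c d f p (fst h)))
        (at (snd c p, Y))"
      by (rule has_derivative_compose[OF 1])
        (simp add: jacobian_works[OF smooth_map_differentiable[OF f c d]])
    show "((\<lambda>z. slope_map (?M (fst z)) (snd z)) has_derivative
        (\<lambda>h. graph_conormal (slope_map M Y) **
          (G' ** J' (fst h) ** matrix_inv G ** graph_frame Y + M ** (fibre_incl ** snd h)) **
          matrix_inv (base_proj ** M ** graph_frame Y))) (at (snd c p, Y))"
      using has_derivative_slope_map[OF M' 2] inv by (simp add: M_def)
  qed
  moreover have "\<forall>\<^sub>F z in nhds (snd c p, Y). (local_rep c d f (fst z), slope_map (?M (fst z)) (snd z)) =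
      local_rep (plane_chart E c G) (plane_chart E' d G') F z"
  proof -
    let ?K = "\<lambda>z. base_proj ** ?M (fst z) ** graph_frame (snd z)"
    have M_lim: "((\<lambda>z. ?M (fst z)) \<longlongrightarrow> ?M (fst (snd c p, Y))) (nhds (snd c p, Y))"
      using has_derivative_continuous[OF M']
        tendsto_at_iff_tendsto_nhds[of "\<lambda>z. ?M (fst z)" "(snd c p, Y)"]
      by (simp add: continuous_within)
    have frame_lim: "((\<lambda>z :: (real^('n + 'm)) \<times> (real^'n^'m). graph_frame (snd z) :: real^'n^('n + 'm)) \<longlongrightarrow>
        graph_frame (snd (snd c p, Y))) (nhds (snd c p, Y))"
      unfolding graph_frame_def
      by (intro tendsto_intros bounded_bilinear.tendsto[OF mm] filterlim_ident)
    have "(?K \<longlongrightarrow> ?K (snd c p, Y)) (nhds (snd c p, Y))"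
      by (rule bounded_bilinear.tendsto[OF mm bounded_bilinear.tendsto[OF mm tendsto_const M_lim] frame_lim])
    then have K: "\<forall>\<^sub>F z in nhds (snd c p, Y). invertible (?K z)"
      using tendsto_imp_eventually_ne[OF tendsto_det] inv by (fastforce simp: invertible_det_nz)
    show ?thesis
      using K eventually_nhds_fst[OF smooth_map_eventually[OF
            smooth_manifold_chart(1)[OF E charts_atD(1)[OF c]] f c d]]
    proof eventually_elim
      case (elim z)
      define q where "q = chart_inv c (fst z)"
      have q: "c \<in> charts_at E q" "d \<in> charts_at E' (f q)" and z: "z = (snd c q, snd z)"
        using elim charts_atD(1)[OF c] charts_atD(1)[OF d]
        by (auto simp: q_def charts_at_def prod_eq_iff)
      have x: "snd c q = fst z" using z by (metis fst_conv)
      have "chart_inv (plane_chart E c G) z = (q, plane_of E c G q (snd z))"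
        by (subst z) (rule chart_inv_plane_chart[OF E q(1) G])
      moreover have "F (q, plane_of E c G q (snd z)) =
          (f q, tangent_map E E' f q ` plane_of E c G q (snd z))"
        using F[OF _ charts_atD(2)[OF q(1)], of "plane_of E c G q (snd z)"]
        by (auto simp: J1_lift_def plane_of_def)
      moreover have "(\<lambda>\<xi>. G' *v \<xi> d) ` tangent_map E E' f q ` plane_of E c G q (snd z) =
          graph_plane (slope_map (?M (fst z)) (snd z))"
        unfolding image_tangent_map_plane[OF E f q G] x by (rule image_graph_plane[OF elim(1)])
      ultimately have "local_rep (plane_chart E c G) (plane_chart E' d G') F z =
          (snd d (f q), slope_map (?M (fst z)) (snd z))"
        by (simp add: local_rep_def plane_chart_def the_graph_plane)
      then show ?case by (simp add: local_rep_def q_def)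
    qed
  qed
  ultimately show ?thesis
    unfolding W plane_of_in_chart(2)[OF E c G] by (rule has_derivative_eventually_eq)
qed

text \<open>Conjugating the transformation law of the connection matrices by the fibre coordinates G and
  \<open>G'\<close> gives the law that the velocities of slopes require.\<close>

lemma plane_lift_transform:
  fixes E :: "('a, real^('n::finite + 'm::finite)) atlas" and E' :: "('b, real^('n + 'm)) atlas"
  assumes E: "smooth_manifold E" and \<Gamma>: "linear_connection E \<Gamma>"
    and E': "smooth_manifold E'" and \<Gamma>': "linear_connection E' \<Gamma>'"
    and f: "smooth_map E E' f"
    and rel: "related_connections E (tangent_bundle E) fst E' (tangent_bundle E') f
      (tangent_lift E E' f) \<Gamma> \<Gamma>'"
    and c: "c \<in> E" "invertible G" "y \<in> fst (plane_chart E c G)"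
    and d: "d \<in> E'" "invertible G'" "F y \<in> fst (plane_chart E' d G')"
    and F: "\<And>q V. V \<subseteq> tangent_space E q \<Longrightarrow> q \<in> fst c \<Longrightarrow> F (q, V) = J1_lift E E' f (q, V)"
    and \<xi>: "\<xi> \<in> tangent_space E (fst y)"
  shows "jacobian (plane_chart E c G) (plane_chart E' d G') F y (plane_lift E \<Gamma> c G y \<xi>) =
    plane_lift E' \<Gamma>' d G' (F y) (tangent_map E E' f (fst y) \<xi>)"
proof -
  obtain p W where y: "y = (p, W)" by fastforce
  obtain Y where cp: "c \<in> charts_at E p" and W: "W = plane_of E c G p Y"
    using plane_chart_domainE[OF E c(1,2)] c(3) unfolding y by blast
  have Fy: "F y = (f p, tangent_map E E' f p ` W)"
    using F[of W p] charts_atD(2)[OF cp] unfolding y W by (auto simp: J1_lift_def plane_of_def)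
  obtain Y' where dp: "d \<in> charts_at E' (f p)" and W': "tangent_map E E' f p ` W = plane_of E' d G' (f p) Y'"
    using plane_chart_domainE[OF E' d(1,2)] d(3) unfolding Fy by blast
  have \<xi>p: "\<xi> \<in> tangent_space E p" using \<xi> y by simp
  let ?J = "jacobian_matrix c d f (snd c p)" and ?\<xi>' = "tangent_map E E' f p \<xi>"
  let ?A = "connection_matrix E \<Gamma> c p \<xi>" and ?A' = "connection_matrix E' \<Gamma>' d (f p) ?\<xi>'"
  define M where "M = G' ** ?J ** matrix_inv G"
  define B where "B = G ** ?A ** matrix_inv G"
  define B' where "B' = G' ** ?A' ** matrix_inv G'"
  have "(*v) M ` graph_plane Y = graph_plane Y'"
    using image_tangent_map_plane[OF E f cp dp c(2), of G' Y] plane_of_components(2)[OF E' dp d(2), of Y']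
    by (simp add: M_def W W'[symmetric])
  note inv = image_graph_plane_eqD(1)[OF this] and slope = image_graph_plane_eqD(2)[OF this]
  obtain J' where J': "(jacobian_matrix c d f has_derivative J') (at (snd c p))"
    using jacobian_matrix_differentiable[OF f cp dp] by blast
  have law: "?A' ** ?J = J' (\<xi> c) + ?J ** ?A"
    by (rule connection_matrix_transform[OF E \<Gamma> E' \<Gamma>' f rel cp dp \<xi>p J'])
  have "B' ** M = G' ** ?A' ** (matrix_inv G' ** G') ** ?J ** matrix_inv G"
    by (simp add: B'_def M_def matrix_mul_assoc)
  also have "\<dots> = G' ** (?A' ** ?J) ** matrix_inv G"
    by (simp add: matrix_inv_left[OF d(2)] matrix_mul_assoc)
  also have "\<dots> = G' ** J' (\<xi> c) ** matrix_inv G + G' ** ?J ** (matrix_inv G ** G) ** ?A ** matrix_inv G"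
    by (simp add: law matrix_inv_left[OF c(2)] matrix_mul_assoc matrix_add_ldistrib matrix_add_rdistrib)
  also have "\<dots> = G' ** J' (\<xi> c) ** matrix_inv G + M ** B"
    by (simp add: M_def B_def matrix_mul_assoc)
  finally have conj_law: "B' ** M = G' ** J' (\<xi> c) ** matrix_inv G + M ** B" .
  have lift: "plane_lift E \<Gamma> c G y \<xi> = (\<xi> c, graph_conormal Y ** B ** graph_frame Y)"
    by (simp add: plane_lift_def plane_velocity_def B_def y W plane_of_in_chart(2)[OF E cp c(2)])
  have lift': "plane_lift E' \<Gamma>' d G' (F y) (tangent_map E E' f (fst y) \<xi>) =
      (?\<xi>' d, graph_conormal Y' ** B' ** graph_frame Y')"
    by (simp add: plane_lift_def plane_velocity_def B'_def Fy W' plane_of_in_chart(2)[OF E' dp d(2)])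
      (simp add: y)
  have "jacobian (plane_chart E c G) (plane_chart E' d G') F y (plane_lift E \<Gamma> c G y \<xi>) =
      (jacobian c d f p (\<xi> c), graph_conormal (slope_map M Y) **
        (G' ** J' (\<xi> c) ** matrix_inv G ** graph_frame Y +
          M ** (fibre_incl ** (graph_conormal Y ** B ** graph_frame Y))) **
        matrix_inv (base_proj ** M ** graph_frame Y))"
    using jacobianI[OF J1_lift_has_derivative[OF E f cp dp c(2) d(2) F W inv[unfolded M_def] J']]
    unfolding lift by (simp add: y M_def)
  also have "\<dots> = (?\<xi>' d, graph_conormal Y' ** B' ** graph_frame Y')"
    using slope_velocity_transform[OF inv conj_law] tangent_map_component[OF E f \<xi>p cp dp]
    by (simp add: slope)
  finally show ?thesis using lift' by simp
qed

text \<open>A chart of the bundle of planes does not determine the pair (c, G) it is built from: a multiple of G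
  gives the same chart. Hence the choice, which is shown below to be irrelevant.\<close>

definition J1_connection ::
    "('a, real^('n::finite + 'm::finite)) atlas \<Rightarrow> ('a, real^('n + 'm)) tangent_lifting \<Rightarrow>
     ('a, 'n, 'm) J1_lifting" where
  "J1_connection E \<Gamma> y \<xi> d = (if d \<in> charts_at (J1 E) y
     then (let (c, G) = (SOME (c, G). c \<in> E \<and> invertible G \<and> d = plane_chart E c G)
       in plane_lift E \<Gamma> c G y \<xi>)
     else 0)"

lemma J1_lift_ident:
  assumes "smooth_manifold E" "c \<in> E" "q \<in> fst c" "V \<subseteq> tangent_space E q"
  shows "(q, V) = J1_lift E E (\<lambda>q. q) (q, V)"
proof -
  have "tangent_map E E (\<lambda>q. q) q \<xi> = \<xi>" if "\<xi> \<in> V" for \<xi>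
    using tangent_map_ident[OF assms(1), of \<xi> q c] assms that by (auto simp: charts_at_def)
  then show ?thesis by (simp add: J1_lift_def)
qed

lemma plane_lift_transition:
  fixes E :: "('a, real^('n::finite + 'm::finite)) atlas"
  assumes E: "smooth_manifold E" and \<Gamma>: "linear_connection E \<Gamma>"
    and c: "c \<in> E" "invertible G" "y \<in> fst (plane_chart E c G)"
    and d: "d \<in> E" "invertible G'" "y \<in> fst (plane_chart E d G')"
    and \<xi>: "\<xi> \<in> tangent_space E (fst y)"
  shows "jacobian (plane_chart E c G) (plane_chart E d G') (\<lambda>y. y) y (plane_lift E \<Gamma> c G y \<xi>) =
    plane_lift E \<Gamma> d G' y \<xi>"
proof -
  \<comment> \<open>A transition map is the local representative of the identity.\<close>
  have rel: "related_connections E (tangent_bundle E) fst E (tangent_bundle E) (\<lambda>q. q)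
      (tangent_lift E E (\<lambda>q. q)) \<Gamma> \<Gamma>"
    using related_connections_ident[OF E] \<Gamma> by (simp add: linear_connection_def)
  have "fst y \<in> fst c" using c(3) by (auto simp: plane_chart_def)
  then have "tangent_map E E (\<lambda>q. q) (fst y) \<xi> = \<xi>"
    using tangent_map_ident[OF E \<xi>, of c] c(1) by (simp add: charts_at_def)
  then show ?thesis
    using plane_lift_transform[OF E \<Gamma> E \<Gamma> smooth_map_ident[OF E] rel c d
        J1_lift_ident[OF E c(1)] \<xi>] by simp
qed

text \<open>Two representations (c, G) of the same chart are related by the transition map from that
  chart to itself, whose derivative is the identity.\<close>

lemma J1_connection_component:
  fixes E :: "('a, real^('n::finite + 'm::finite)) atlas"
  assumes E: "smooth_manifold E" and \<Gamma>: "linear_connection E \<Gamma>"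
    and c: "c \<in> E" "invertible G" "y \<in> fst (plane_chart E c G)"
    and \<xi>: "\<xi> \<in> tangent_space E (fst y)"
  shows "J1_connection E \<Gamma> y \<xi> (plane_chart E c G) = plane_lift E \<Gamma> c G y \<xi>"
proof -
  let ?P = "\<lambda>(c', G'). c' \<in> E \<and> invertible G' \<and> plane_chart E c G = plane_chart E c' G'"
  obtain c' G' where c'G': "(SOME x. ?P x) = (c', G')" by fastforce
  have "?P (SOME x. ?P x)" by (rule someI[of ?P "(c, G)"]) (simp add: c)
  then have c': "c' \<in> E" "invertible G'" and eq: "plane_chart E c G = plane_chart E c' G'"
    by (simp_all add: c'G')
  have "open (snd (plane_chart E c G) ` fst (plane_chart E c G))"
    using plane_chart_image[OF E c(1,2), of "\<lambda>_. True"] smooth_manifold_chart(2)[OF E c(1)]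
    by (simp add: open_Times)
  from jacobian_ident[OF inj_plane_chart[OF E c(1,2)] this c(3)]
  have "plane_lift E \<Gamma> c G y \<xi> = plane_lift E \<Gamma> c' G' y \<xi>"
    using plane_lift_transition[OF E \<Gamma> c c' c(3)[unfolded eq] \<xi>] by (simp add: eq)
  moreover have "plane_chart E c G \<in> charts_at (J1 E) y"
    unfolding charts_at_def J1_def mem_Collect_eq
    by (intro conjI exI[of _ c] exI[of _ G] refl c)
  ultimately show ?thesis by (simp add: J1_connection_def c'G')
qed

lemma charts_at_J1E:
  assumes "d \<in> charts_at (J1 E) y"
  obtains c G where "c \<in> E" "invertible G" "y \<in> fst (plane_chart E c G)" "d = plane_chart E c G"
  using assms by (auto simp: charts_at_def J1_def)

lemma J1_connection_lift:
  fixes E :: "('a, real^('n::finite + 'm::finite)) atlas"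
  assumes E: "smooth_manifold E" and \<Gamma>: "linear_connection E \<Gamma>"
    and y: "y \<in> points (J1 E)" and \<xi>: "\<xi> \<in> tangent_space E (fst y)"
  shows "J1_connection E \<Gamma> y \<xi> \<in> tangent_space (J1 E) y"
    and "tangent_map (J1 E) E fst y (J1_connection E \<Gamma> y \<xi>) = \<xi>"
proof -
  show "J1_connection E \<Gamma> y \<xi> \<in> tangent_space (J1 E) y"
  proof (rule tangent_spaceI)
    fix d e assume "d \<in> charts_at (J1 E) y" "e \<in> charts_at (J1 E) y"
    then show "jacobian d e (\<lambda>q. q) y (J1_connection E \<Gamma> y \<xi> d) = J1_connection E \<Gamma> y \<xi> e"
      by (elim charts_at_J1E)
        (simp add: J1_connection_component[OF E \<Gamma> _ _ _ \<xi>] plane_lift_transition[OF E \<Gamma> _ _ _ _ _ _ \<xi>])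
  qed (simp add: J1_connection_def)
  obtain e where "e \<in> charts_at (J1 E) y" using y by (auto simp: points_def charts_at_def)
  then have "(SOME e. e \<in> charts_at (J1 E) y) \<in> charts_at (J1 E) y" by (rule someI)
  then obtain c G where c: "c \<in> E" "invertible G" "y \<in> fst (plane_chart E c G)"
      and e: "(SOME e. e \<in> charts_at (J1 E) y) = plane_chart E c G"
    by (rule charts_at_J1E)
  obtain p W where yp: "y = (p, W)" by fastforce
  obtain Y where cp: "c \<in> charts_at E p" and W: "W = plane_of E c G p Y"
    using plane_chart_domainE[OF E c(1,2)] c(3) unfolding yp by blast
  have \<xi>p: "\<xi> \<in> tangent_space E p" using \<xi> yp by simp
  note ident = smooth_map_ident[OF E]
  show "tangent_map (J1 E) E fst y (J1_connection E \<Gamma> y \<xi>) = \<xi>"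
  proof
    fix d
    show "tangent_map (J1 E) E fst y (J1_connection E \<Gamma> y \<xi>) d = \<xi> d"
    proof (cases "d \<in> charts_at E p")
      case d: True
      have "(local_rep (plane_chart E c G) d fst has_derivative (\<lambda>h. jacobian c d (\<lambda>q. q) p (fst h)))
          (at (snd (plane_chart E c G) y))"
        unfolding yp W plane_of_in_chart(2)[OF E cp c(2)]
      proof (rule has_derivative_eventually_eq)
        show "((\<lambda>z. local_rep c d (\<lambda>q. q) (fst z)) has_derivative
            (\<lambda>h. jacobian c d (\<lambda>q. q) p (fst h))) (at (snd c p, Y))"
          by (rule has_derivative_compose[OF bounded_linear_imp_has_derivative[OF bounded_linear_fst]])
            (simp add: jacobian_works[OF smooth_map_differentiable[OF ident cp d]])
        show "\<forall>\<^sub>F z in nhds (snd c p, Y).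
            local_rep c d (\<lambda>q. q) (fst z) = local_rep (plane_chart E c G) d fst z"
          using eventually_nhds_fst[OF smooth_map_eventually[OF
                smooth_manifold_chart(1)[OF E c(1)] ident cp d]]
        proof eventually_elim
          case (elim z)
          have "c \<in> charts_at E (chart_inv c (fst z))" using elim c(1) by (simp add: charts_at_def)
          from chart_inv_plane_chart[OF E this c(2), of "snd z"] show ?case
            using elim by (simp add: local_rep_def)
        qed
      qed
      then have "jacobian (plane_chart E c G) d fst y (J1_connection E \<Gamma> y \<xi> (plane_chart E c G)) =
          jacobian c d (\<lambda>q. q) p (\<xi> c)"
        by (simp add: jacobianI J1_connection_component[OF E \<Gamma> c \<xi>] plane_lift_def)
      then show ?thesis
        using d tangent_space_transform[OF \<xi>p cp d] e by (simp add: tangent_map_def yp Let_def)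
    next
      case False
      then show ?thesis using tangent_space_outside[OF \<xi>p] by (simp add: tangent_map_def yp)
    qed
  qed
qed

lemma connection_matrix_linear:
  assumes E: "smooth_manifold E" and \<Gamma>: "linear_connection E \<Gamma>" and c: "c \<in> charts_at E p"
    and \<xi>: "\<xi> \<in> tangent_space E p" and \<eta>: "\<eta> \<in> tangent_space E p"
  shows "connection_matrix E \<Gamma> c p (\<lambda>c. a *\<^sub>R \<xi> c + b *\<^sub>R \<eta> c) =
    a *\<^sub>R connection_matrix E \<Gamma> c p \<xi> + b *\<^sub>R connection_matrix E \<Gamma> c p \<eta>"
proof -
  have \<Gamma>c: "connection E (tangent_bundle E) fst \<Gamma>" using \<Gamma> by (simp add: linear_connection_def)
  have "lift_coeff E \<Gamma> c p (\<lambda>c. a *\<^sub>R \<xi> c + b *\<^sub>R \<eta> c) (tvec_of E c p v) =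
      a *\<^sub>R lift_coeff E \<Gamma> c p \<xi> (tvec_of E c p v) + b *\<^sub>R lift_coeff E \<Gamma> c p \<eta> (tvec_of E c p v)" for v
  proof -
    have "tangent_chart E c \<in> charts_at (tangent_bundle E) (p, tvec_of E c p v)"
      using c tvec_of_in_tangent_space[OF E c] by (auto simp: charts_at_tangent_bundle)
    from connection_linear[OF \<Gamma>c points_charts_at[OF this]] \<xi> \<eta> show ?thesis
      by (simp add: lift_coeff_def)
  qed
  then show ?thesis by (simp add: connection_matrix_def matrix_def vec_eq_iff)
qed

lemma plane_lift_linear:
  fixes E :: "('a, real^('n::finite + 'm::finite)) atlas"
  assumes E: "smooth_manifold E" and \<Gamma>: "linear_connection E \<Gamma>" and c: "c \<in> charts_at E (fst y)"
    and \<xi>: "\<xi> \<in> tangent_space E (fst y)" and \<eta>: "\<eta> \<in> tangent_space E (fst y)"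
  shows "plane_lift E \<Gamma> c G y (\<lambda>c. a *\<^sub>R \<xi> c + b *\<^sub>R \<eta> c) =
    a *\<^sub>R plane_lift E \<Gamma> c G y \<xi> + b *\<^sub>R plane_lift E \<Gamma> c G y \<eta>"
  by (simp add: plane_lift_def plane_velocity_def connection_matrix_linear[OF E \<Gamma> c \<xi> \<eta>]
      matrix_add_ldistrib matrix_add_rdistrib
      bounded_bilinear.scaleR_left[OF bounded_bilinear_matrix_mult]
      bounded_bilinear.scaleR_right[OF bounded_bilinear_matrix_mult])

text \<open>The coefficients of the given connection, at constant fibre components w, are smooth functions of
  the base point; they are the columns of the connection matrix.\<close>

lemma J1_connection_smooth:
  fixes E :: "('a, real^('n::finite + 'm::finite)) atlas"
  assumes E: "smooth_manifold E" and \<Gamma>: "linear_connection E \<Gamma>"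
    and b: "b \<in> E" and c: "c \<in> E" "invertible G"
  defines "d \<equiv> plane_chart E c G"
  shows "smooth_on (snd d ` {y \<in> fst d. fst y \<in> fst b})
    (\<lambda>z. let y = chart_inv d z in J1_connection E \<Gamma> y (tvec_of E b (fst y) v) d)"
  unfolding smooth_on_def
proof
  fix k
  have \<Gamma>c: "connection E (tangent_bundle E) fst \<Gamma>" using \<Gamma> by (simp add: linear_connection_def)
  let ?U = "snd c ` {p \<in> fst c. p \<in> fst b}"
  let ?O = "?U \<times> (UNIV :: (real^'n^'m) set)"
  let ?q = "\<lambda>z. chart_inv c (fst z)" and ?t = "tangent_chart E c"
  have "open ?U" using smooth_map_ident[OF E] b c(1) unfolding smooth_map_def by blast
  then have O: "open ?O" by (simp add: open_Times)
  have q: "c \<in> charts_at E (?q z) \<and> b \<in> charts_at E (?q z) \<and> snd c (?q z) = fst z" if "z \<in> ?O" for z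
    using that b c(1) smooth_manifold_chart(1)[OF E c(1)]
    by (auto simp: charts_at_def chart_inv_chart)
  have \<Gamma>_smooth: "Ck_on k ?O (\<lambda>z. \<Gamma> (?q z, tvec_of E c (?q z) w) (tvec_of E b (?q z) v) ?t)" for w
  proof (rule Ck_on_cong[OF O])
    have "smooth_on (snd ?t ` {y \<in> fst ?t. fst y \<in> fst b})
        (\<lambda>z. let y = chart_inv ?t z in \<Gamma> y (tvec_of E b (fst y) v) ?t)"
      using \<Gamma>c b c(1) unfolding connection_def tangent_bundle_def by blast
    then have "Ck_on k (?U \<times> UNIV) (\<lambda>z. let y = chart_inv ?t z in \<Gamma> y (tvec_of E b (fst y) v) ?t)"
      unfolding tangent_chart_image[OF E c(1), of "\<lambda>p. p \<in> fst b"] smooth_on_def by blast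
    then show "Ck_on k ?O (\<lambda>z. let y = chart_inv ?t ((fst z, 0) + (0, w)) in
        \<Gamma> y (tvec_of E b (fst y) v) ?t)"
      \<comment> \<open>Precomposition with \<open>(x, Y) \<mapsto> (x, w)\<close>.\<close>
      by (rule Ck_on_affine_right[OF O, rotated 2]) (auto intro!: linearI)
    show "(let y = chart_inv ?t ((fst z, 0) + (0, w)) in \<Gamma> y (tvec_of E b (fst y) v) ?t) =
        \<Gamma> (?q z, tvec_of E c (?q z) w) (tvec_of E b (?q z) v) ?t" if "z \<in> ?O" for z
      using chart_inv_tangent_chart[OF E, of c "?q z" w] q[OF that] by simp
  qed
  have base: "Ck_on k ?O (\<lambda>z. tvec_of E b (?q z) v c)"
  proof (rule Ck_on_cong[OF O])
    show "Ck_on k ?O (\<lambda>z. fst (\<Gamma> (?q z, tvec_of E c (?q z) 0) (tvec_of E b (?q z) v) ?t))"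
      by (rule Ck_on_linear_left[OF O _ \<Gamma>_smooth]) (simp add: linear_fst)
    show "fst (\<Gamma> (?q z, tvec_of E c (?q z) 0) (tvec_of E b (?q z) v) ?t) = tvec_of E b (?q z) v c"
      if "z \<in> ?O" for z
      using q[OF that] by (intro tangent_lifting_base_component[OF E \<Gamma>c]) (auto intro: tvec_of_in_tangent_space[OF E])
  qed
  have A: "Ck_on k ?O (\<lambda>z. connection_matrix E \<Gamma> c (?q z) (tvec_of E b (?q z) v))"
    unfolding connection_matrix_def lift_coeff_def
    by (intro Ck_on_matrix[OF O] Ck_on_linear_left[OF O linear_snd \<Gamma>_smooth])
  note mult = Ck_on_bilinear[OF O bounded_bilinear_matrix_mult]
  have Y: "Ck_on k ?O (\<lambda>z. snd z)" by (rule Ck_on_linear[OF O linear_snd])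
  have frame: "Ck_on k ?O (\<lambda>z. graph_frame (snd z) :: real^'n^('n + 'm))"
    unfolding graph_frame_def by (intro Ck_on_add[OF O] mult Ck_on_const Y)
  have conormal: "Ck_on k ?O (\<lambda>z. graph_conormal (snd z) :: real^('n + 'm)^'m)"
  proof -
    have eq: "graph_conormal Y = fibre_proj + Y ** (- base_proj :: real^('n + 'm)^'n)" for Y :: "real^'n^'m"
      using bounded_bilinear.minus_right[OF bounded_bilinear_matrix_mult, of Y "base_proj :: real^('n + 'm)^'n"]
      unfolding graph_conormal_def by (metis diff_conv_add_uminus)
    show ?thesis
      unfolding eq by (rule Ck_on_add[OF O Ck_on_const mult[OF Y Ck_on_const]])
  qed
  have smooth: "Ck_on k ?O (\<lambda>z. (tvec_of E b (?q z) v c,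
      plane_velocity E \<Gamma> c G (?q z) (tvec_of E b (?q z) v) (snd z)))"
    unfolding plane_velocity_def
    by (intro Ck_on_Pair[OF O base] mult Ck_on_const conormal frame A)
  have eq: "(tvec_of E b (?q z) v c,
      plane_velocity E \<Gamma> c G (?q z) (tvec_of E b (?q z) v) (snd z)) =
      (let y = chart_inv d z in J1_connection E \<Gamma> y (tvec_of E b (fst y) v) d)" if "z \<in> ?O" for z
  proof -
    have "chart_inv d z = (?q z, plane_of E c G (?q z) (snd z))"
      using chart_inv_plane_chart[OF E _ c(2), of c "?q z" "snd z"] q[OF that] by (simp add: d_def)
    then show ?thesis
      using J1_connection_component[OF E \<Gamma> c, of "(?q z, plane_of E c G (?q z) (snd z))" "tvec_of E b (?q z) v"]
        plane_of_in_chart[OF E _ c(2), of c "?q z" "snd z"]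
        tvec_of_in_tangent_space[OF E, of b "?q z" v] q[OF that]
      by (simp add: d_def plane_lift_def)
  qed
  have "Ck_on k ?O (\<lambda>z. let y = chart_inv d z in J1_connection E \<Gamma> y (tvec_of E b (fst y) v) d)"
    by (rule Ck_on_cong[OF O eq smooth])
  then show "Ck_on k (snd d ` {y \<in> fst d. fst y \<in> fst b})
      (\<lambda>z. let y = chart_inv d z in J1_connection E \<Gamma> y (tvec_of E b (fst y) v) d)"
    unfolding d_def plane_chart_image[OF E c, of "\<lambda>p. p \<in> fst b"] .
qed

lemma J1_connection_is_connection:
  fixes E :: "('a, real^('n::finite + 'm::finite)) atlas"
  assumes E: "smooth_manifold E" and \<Gamma>: "linear_connection E \<Gamma>"
  shows "connection E (J1 E) fst (J1_connection E \<Gamma>)"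
  unfolding connection_def
proof (intro conjI ballI allI)
  fix y \<xi> assume y: "y \<in> points (J1 E)" and \<xi>: "\<xi> \<in> tangent_space E (fst y)"
  show "J1_connection E \<Gamma> y \<xi> \<in> tangent_space (J1 E) y"
      "tangent_map (J1 E) E fst y (J1_connection E \<Gamma> y \<xi>) = \<xi>"
    by (rule J1_connection_lift[OF E \<Gamma> y \<xi>])+
  fix \<eta> and a b :: real assume \<eta>: "\<eta> \<in> tangent_space E (fst y)"
  show "J1_connection E \<Gamma> y (\<lambda>c. a *\<^sub>R \<xi> c + b *\<^sub>R \<eta> c) =
      (\<lambda>d. a *\<^sub>R J1_connection E \<Gamma> y \<xi> d + b *\<^sub>R J1_connection E \<Gamma> y \<eta> d)"
  proof
    fix d
    show "J1_connection E \<Gamma> y (\<lambda>c. a *\<^sub>R \<xi> c + b *\<^sub>R \<eta> c) d =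
        a *\<^sub>R J1_connection E \<Gamma> y \<xi> d + b *\<^sub>R J1_connection E \<Gamma> y \<eta> d"
    proof (cases "d \<in> charts_at (J1 E) y")
      case True
      then obtain c G where c: "c \<in> E" "invertible G" "y \<in> fst (plane_chart E c G)"
          and d: "d = plane_chart E c G"
        by (rule charts_at_J1E)
      have "c \<in> charts_at E (fst y)" using c by (auto simp: charts_at_def plane_chart_def)
      then show ?thesis
        unfolding d
        by (simp add: J1_connection_component[OF E \<Gamma> c] \<xi> \<eta> tangent_space_linear[OF E]
            plane_lift_linear[OF E \<Gamma>])
    qed (simp add: J1_connection_def)
  qed
next
  fix b d v assume b: "b \<in> E" and "d \<in> J1 E"
  then obtain c G where "c \<in> E" "invertible G" "d = plane_chart E c G" by (auto simp: J1_def)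
  then show "smooth_on (snd d ` {y \<in> fst d. fst y \<in> fst b})
      (\<lambda>z. let y = chart_inv d z in J1_connection E \<Gamma> y (tvec_of E b (fst y) v) d)"
    using J1_connection_smooth[OF E \<Gamma> b] by simp
qed

lemma J1_connection_natural:
  fixes E :: "('a, real^('n::finite + 'm::finite)) atlas" and E' :: "('b, real^('n + 'm)) atlas"
  assumes E: "smooth_manifold E" and \<Gamma>: "linear_connection E \<Gamma>"
    and E': "smooth_manifold E'" and \<Gamma>': "linear_connection E' \<Gamma>'"
    and f: "smooth_map E E' f"
    and rel: "related_connections E (tangent_bundle E) fst E' (tangent_bundle E') f
      (tangent_lift E E' f) \<Gamma> \<Gamma>'"
  shows "related_connections E (J1 E) fst E' (J1 E') f (J1_lift E E' f)
    (J1_connection E \<Gamma>) (J1_connection E' \<Gamma>')"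
  unfolding related_connections_def
proof (intro ballI ext)
  fix y \<xi> e assume y: "y \<in> points (J1 E)" and \<xi>: "\<xi> \<in> tangent_space E (fst y)"
  let ?F = "J1_lift E E' f" and ?\<xi>' = "tangent_map E E' f (fst y) \<xi>"
  show "tangent_map (J1 E) (J1 E') ?F y (J1_connection E \<Gamma> y \<xi>) e = J1_connection E' \<Gamma>' (?F y) ?\<xi>' e"
  proof (cases "e \<in> charts_at (J1 E') (?F y)")
    case True
    then obtain d G' where d: "d \<in> E'" "invertible G'" "?F y \<in> fst (plane_chart E' d G')"
        and e: "e = plane_chart E' d G'"
      by (rule charts_at_J1E)
    obtain a where "a \<in> charts_at (J1 E) y" using y by (auto simp: points_def charts_at_def)
    then have "(SOME a. a \<in> charts_at (J1 E) y) \<in> charts_at (J1 E) y" by (rule someI)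
    then obtain c G where c: "c \<in> E" "invertible G" "y \<in> fst (plane_chart E c G)"
        and a: "(SOME a. a \<in> charts_at (J1 E) y) = plane_chart E c G"
      by (rule charts_at_J1E)
    have "c \<in> charts_at E (fst y)" using c by (auto simp: charts_at_def plane_chart_def)
    then have "?\<xi>' \<in> tangent_space E' (fst (?F y))"
      using tangent_map_in_tangent_space[OF E E' f \<xi>] by (simp add: J1_lift_def split_beta)
    then have "J1_connection E' \<Gamma>' (?F y) ?\<xi>' e = plane_lift E' \<Gamma>' d G' (?F y) ?\<xi>'"
      unfolding e by (rule J1_connection_component[OF E' \<Gamma>' d])
    also have "\<dots> = jacobian (plane_chart E c G) e ?F y (plane_lift E \<Gamma> c G y \<xi>)"
      unfolding e by (rule plane_lift_transform[OF E \<Gamma> E' \<Gamma>' f rel c d refl \<xi>, symmetric])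
    finally show ?thesis
      using True by (simp add: tangent_map_def a Let_def J1_connection_component[OF E \<Gamma> c \<xi>])
  next
    case False
    then show ?thesis by (simp add: tangent_map_def J1_connection_def)
  qed
qed

theorem theorem1:
  shows "\<exists>D :: ('a, real^('n::finite + 'm::finite)) atlas \<Rightarrow>
      ('a, real^('n + 'm)) tangent_lifting \<Rightarrow> ('a, 'n, 'm) J1_lifting.
    (\<forall>E \<Gamma>. smooth_manifold E \<and> linear_connection E \<Gamma> \<and> torsion_free E \<Gamma> \<longrightarrow>
       connection E (J1 E) fst (D E \<Gamma>)) \<and>
    (\<forall>E \<Gamma> E' \<Gamma>' f.
       smooth_manifold E \<and> linear_connection E \<Gamma> \<and> torsion_free E \<Gamma> \<and>
       smooth_manifold E' \<and> linear_connection E' \<Gamma>' \<and> torsion_free E' \<Gamma>' \<and>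
       local_diffeomorphism E E' f \<and>
       related_connections E (tangent_bundle E) fst E' (tangent_bundle E') f
         (tangent_lift E E' f) \<Gamma> \<Gamma>' \<longrightarrow>
       related_connections E (J1 E) fst E' (J1 E') f (J1_lift E E' f) (D E \<Gamma>) (D E' \<Gamma>'))"
  by (intro exI[of _ J1_connection] conjI allI impI; elim conjE)
    (blast intro: J1_connection_is_connection J1_connection_natural local_diffeomorphism_imp_smooth_map)+

end
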